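(* Let $1\le d<D$ and $k\ge1$ be integers. There exist a constant $C_M$ (independent of $\alpha$ and $M$ below) and a constant $M_0$ such that the following holds. Let $\mathcal{M}\subset\mathbb{R}^D$ be a compact $d$-dimensional submanifold without boundary of class $C^k$ with reach $\tau$, let $\sigma>0$, and assume $M=\tau/\sigma>M_0$. Let $r\in\mathcal{M}_\sigma$, let $r_1,\dots,r_n$ be i.i.d. samples from $\mathrm{Unif}(\mathcal{M}_\sigma)$, let $(q^*,H^* )=(q^*(r),H^*(r))$ be the output of Step 1 (see context), and let $p=P_{\mathcal{M}}(q^* )$ be the nearest point of $\mathcal{M}$ to $q^*$. Put $\alpha=\sqrt{C_M/M}$. Then for any arbitrarily small $\delta>0$ there exists $N_\delta$ such that for all $n>N_\delta$, $$\angle_{\max}(H^*,T_p\mathcal{M})\le\alpha$$ with probability at least $1-\delta$. Furthermore, $\|p-q^*\|\le3\sigma$.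
   Context: The reach of $\mathcal{M}$ is the largest $\tau$ such that every point within distance $\tau$ of $\mathcal{M}$ has a unique nearest point on $\mathcal{M}$. $\mathcal{M}_\sigma=\{q\in\mathbb{R}^D:\mathrm{dist}(q,\mathcal{M})<\sigma\}$, with $\mathrm{Unif}(\mathcal{M}_\sigma)$ the normalized Lebesgue measure. $Gr(d,D)$ is the set of $d$-dimensional linear subspaces of $\mathbb{R}^D$ and $\angle_{\max}$ denotes the largest principal angle between two $d$-dimensional subspaces. Step 1: given $r\in\mathcal{M}_\sigma$, let $U_{\mathrm{ROI}}=\{r_i:\|r_i-r\|<\sqrt{\sigma\tau}\}$ with $N_r$ elements, and $$J_1(r;q,H)=\frac1{N_r}\sum_{r_i\in U_{\mathrm{ROI}}}\mathrm{dist}^2(r_i-q,H).$$ The output $(q^*(r),H^*(r))$ is a minimizer of $J_1(r;q,H)$ over all $(q,H)\in\mathbb{R}^D\times Gr(d,D)$ with $r-q\perp H$ and $\|r-q\|<2\sigma$. *)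

theory Defs
  imports "HOL-Analysis.Analysis"
begin

text \<open>Class \<open>C\<^sup>k\<close> on an open set \<open>U\<close>; \<open>frechet_derivative f (at x) v\<close> is the derivative in direction \<open>v\<close>.\<close>

primrec Ck_on :: "nat \<Rightarrow> ('a::real_normed_vector \<Rightarrow> 'b::real_normed_vector) \<Rightarrow> 'a set \<Rightarrow> bool"
  where
    "Ck_on 0 f U \<longleftrightarrow> continuous_on U f"
  | "Ck_on (Suc k) f U \<longleftrightarrow>
       (\<forall>x\<in>U. f differentiable (at x)) \<and>
       (\<forall>v. Ck_on k (\<lambda>x. frechet_derivative f (at x) v) U)"

text \<open>Embedded submanifold (without boundary): around each point a \<open>C\<^sup>k\<close> diffeomorphism between
  open sets of the ambient space straightens \<open>S\<close> to a \<open>d\<close>-dimensional linear subspace \<open>L\<close>.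
  Letting \<open>L\<close> vary instead of fixing a coordinate subspace changes charts by a linear map only.\<close>

definition submanifold :: "nat \<Rightarrow> nat \<Rightarrow> 'a::euclidean_space set \<Rightarrow> bool" where
  "submanifold k d S \<longleftrightarrow>
     (\<forall>p\<in>S. \<exists>U V (\<phi> :: 'a \<Rightarrow> 'a) \<psi> L. open U \<and> p \<in> U \<and> open V \<and> homeomorphism U V \<phi> \<psi> \<and>
        Ck_on k \<phi> U \<and> Ck_on k \<psi> V \<and> subspace L \<and> dim L = d \<and> \<phi> ` (U \<inter> S) = V \<inter> L)"

definition tangent_space :: "'a::euclidean_space set \<Rightarrow> 'a \<Rightarrow> 'a set" where
  "tangent_space S p =
     {v. \<exists>\<gamma> \<epsilon>. \<epsilon> > 0 \<and> \<gamma> C1_differentiable_on {-\<epsilon><..<\<epsilon>} \<and> \<gamma> ` {-\<epsilon><..<\<epsilon>} \<subseteq> S \<and>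
         \<gamma> 0 = p \<and> (\<gamma> has_vector_derivative v) (at 0)}"

text \<open>``Within distance \<open>t\<close>'' has to be strict for the largest such \<open>t\<close> to exist (consider a
  circle); the supremum is then attained whenever it is finite. It is infinite for nonempty
  closed convex sets.\<close>

definition unique_nearest_within :: "'a::euclidean_space set \<Rightarrow> real \<Rightarrow> bool" where
  "unique_nearest_within S t \<longleftrightarrow>
     (\<forall>x. infdist x S < t \<longrightarrow> (\<exists>!p. p \<in> S \<and> dist x p = infdist x S))"

definition reach :: "'a::euclidean_space set \<Rightarrow> ereal" where
  "reach S = Sup {ereal t |t. unique_nearest_within S t}"

text \<open>\<open>{x. dist(x, S) < \<sigma>}\<close>. It is not written with \<^const>\<open>infdist\<close>, which is 0 on the empty set.\<close>

definition tube :: "'a::euclidean_space set \<Rightarrow> real \<Rightarrow> 'a set" where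
  "tube S \<sigma> = {x. \<exists>p\<in>S. dist x p < \<sigma>}"

definition Unif :: "'a::euclidean_space set \<Rightarrow> 'a measure" where
  "Unif A = uniform_measure lborel A"

text \<open>The joint law of \<open>n\<close> i.i.d. samples from \<open>A\<close>, indexed by \<open>{..<n}\<close>.\<close>

definition iid_samples :: "nat \<Rightarrow> 'a::euclidean_space set \<Rightarrow> (nat \<Rightarrow> 'a) measure" where
  "iid_samples n A = PiM {..<n} (\<lambda>_. Unif A)"

definition Gr :: "nat \<Rightarrow> 'a::euclidean_space set set" where
  "Gr d = {H. subspace H \<and> dim H = d}"

text \<open>Recursive definition of principal vectors of two subspaces of equal dimension: the \<open>i\<close>-th
  pair of unit vectors has the smallest possible angle among those orthogonal to all previous ones.\<close>

definition principal_vectors ::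
    "'a::euclidean_space set \<Rightarrow> 'a set \<Rightarrow> (nat \<Rightarrow> 'a) \<Rightarrow> (nat \<Rightarrow> 'a) \<Rightarrow> bool" where
  "principal_vectors U W u w \<longleftrightarrow>
     (\<forall>i<dim U. is_arg_min (\<lambda>(x, y). arccos (x \<bullet> y))
        (\<lambda>(x, y). x \<in> U \<and> y \<in> W \<and> norm x = 1 \<and> norm y = 1 \<and>
           (\<forall>j<i. orthogonal x (u j) \<and> orthogonal y (w j)))
        (u i, w i))"

text \<open>Principal vectors are not unique, but the angles between them do not depend on the choice.\<close>

definition max_principal_angle :: "'a::euclidean_space set \<Rightarrow> 'a set \<Rightarrow> real" where
  "max_principal_angle U W =
     (SOME \<theta>. \<exists>u w. principal_vectors U W u w \<and>
        \<theta> = Max ((\<lambda>i. arccos (u i \<bullet> w i)) ` {..<dim U}))"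

text \<open>Samples are counted by index, i.e. with multiplicity; almost surely they are distinct.\<close>

definition ROI :: "real \<Rightarrow> real \<Rightarrow> 'a::euclidean_space \<Rightarrow> nat \<Rightarrow> (nat \<Rightarrow> 'a) \<Rightarrow> nat set" where
  "ROI \<sigma> \<tau> r n rs = {i. i < n \<and> norm (rs i - r) < sqrt (\<sigma> * \<tau>)}"

text \<open>If the region of interest contains no sample, \<open>J1\<close> is identically 0.\<close>

definition J1 ::
    "real \<Rightarrow> real \<Rightarrow> 'a::euclidean_space \<Rightarrow> nat \<Rightarrow> (nat \<Rightarrow> 'a) \<Rightarrow> 'a \<Rightarrow> 'a set \<Rightarrow> real" where
  "J1 \<sigma> \<tau> r n rs q H =
     1 / real (card (ROI \<sigma> \<tau> r n rs)) * (\<Sum>i\<in>ROI \<sigma> \<tau> r n rs. (infdist (rs i - q) H)\<^sup>2)"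

text \<open>\<open>(q, H)\<close> is a possible output of Step 1 on the samples \<open>rs 0, \<dots>, rs (n - 1)\<close>.\<close>

definition step1_output ::
    "nat \<Rightarrow> real \<Rightarrow> real \<Rightarrow> 'a::euclidean_space \<Rightarrow> nat \<Rightarrow> (nat \<Rightarrow> 'a) \<Rightarrow> 'a \<Rightarrow> 'a set \<Rightarrow> bool" where
  "step1_output d \<sigma> \<tau> r n rs q H \<longleftrightarrow>
     is_arg_min (\<lambda>(q, H). J1 \<sigma> \<tau> r n rs q H)
       (\<lambda>(q, H). H \<in> Gr d \<and> (\<forall>h\<in>H. orthogonal (r - q) h) \<and> norm (r - q) < 2 * \<sigma>)
       (q, H)"

end

theory Submission
  imports Defs "HOL-Probability.Probability"
begin

text \<open>Write \<open>\<pi>\<close> for the nearest point map of a submanifold \<open>S\<close> of reach \<open>\<tau>\<close>. A segment from \<open>\<pi> x\<close> to \<open>x\<close>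
  can be prolonged up to length \<open>\<tau>\<close> without changing the nearest point, so a unit normal \<open>n\<close> at \<open>p\<close>
  satisfies \<open>n \<bullet> (x - p) \<le> \<bar>x - p\<bar>\<^sup>2 / 2\<tau>\<close> for all \<open>x \<in> S\<close>. Let \<open>K a\<close> be the largest sine of the angle
  between a tangent vector at \<open>p\<close> and the tangent space at \<open>m\<close> with \<open>\<bar>p - m\<bar> \<le> a\<close>. The inequality at the
  nearest point of \<open>p + s u\<close>, with \<open>u\<close> a unit tangent vector at \<open>p\<close>, bounds the distance of \<open>p + s u\<close>
  to \<open>S\<close> by \<open>s K (2s) + 2s\<^sup>2/\<tau>\<close>; testing normals at \<open>m\<close> against that nearest point with \<open>s = a/4\<close> gives
  \<open>K a \<le> K (a/2) + 7a/\<tau>\<close>. As \<open>K\<close> vanishes at 0, \<open>K a \<le> 14a/\<tau>\<close>, and \<open>S\<close> and its tangent space at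
  \<open>p\<close> stay \<open>O(s\<^sup>2/\<tau>)\<close> close to each other at scale \<open>s\<close>.

  At scale \<open>R = sqrt (\<sigma> \<tau>)\<close> this error is of order \<open>\<sigma>\<close>. So with \<open>p = \<pi> r\<close> the candidate \<open>(p, T\<^sub>p S)\<close>
  has cost at most \<open>4\<sigma>\<^sup>2\<close>, and hence so has a minimizer \<open>(q, H)\<close>. For each vector \<open>b\<close> of an orthonormal
  basis of \<open>T\<^sub>p S\<close>, a fixed fraction of the samples near \<open>r\<close> lies close to \<open>p + R b / 25\<close>, so one of
  them is at distance \<open>O(\<sigma>)\<close> from \<open>r + H\<close>. This forces the angle between \<open>T\<^sub>p S\<close> and \<open>H\<close> to be
  \<open>O(\<sigma>/R)\<close>, that is \<open>O(sqrt (\<sigma>/\<tau>))\<close>; passing from \<open>p\<close> to \<open>\<pi> q\<close> costs only \<open>O(\<sigma>/\<tau>)\<close>.\<close>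


section \<open>Orthogonal projections\<close>

lemma orthogonal_projection_exists:
  fixes S :: "'a::euclidean_space set"
  assumes "subspace S"
  obtains P where "linear P" "\<And>x. P x \<in> S" "\<And>x s. s \<in> S \<Longrightarrow> (x - P x) \<bullet> s = 0"
proof -
  obtain B where B: "B \<subseteq> S" "pairwise orthogonal B" "\<And>x. x \<in> B \<Longrightarrow> norm x = 1"
      "independent B" "span B = S"
    using orthonormal_basis_subspace[OF assms] by metis
  have fin: "finite B" using B(4) independent_imp_finite by blast
  define P where "P = (\<lambda>x. \<Sum>b\<in>B. (x \<bullet> b) *\<^sub>R b)"
  have "linear P"
    unfolding P_def
    by (rule linearI) (auto simp: inner_add_left scaleR_add_left sum.distrib scaleR_sum_right)
  moreover have "P x \<in> S" for x
    unfolding P_def using B(1) assms by (intro subspace_sum) (auto simp: subspace_scale)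
  moreover have "(x - P x) \<bullet> s = 0" if "s \<in> S" for x s
  proof -
    have b: "orthogonal (x - P x) b" if "b \<in> B" for b
    proof -
      have "P x \<bullet> b = (\<Sum>c\<in>B. (x \<bullet> c) * (c \<bullet> b))"
        by (simp add: P_def inner_sum_left)
      also have "\<dots> = (\<Sum>c\<in>B. if c = b then x \<bullet> b else 0)"
        using B(2,3) that by (intro sum.cong) (auto simp: pairwise_def orthogonal_def norm_eq_1)
      also have "\<dots> = x \<bullet> b" using fin that by simp
      finally show ?thesis by (simp add: orthogonal_def inner_diff_left)
    qed
    have "s \<in> span B" using B(5) that by simp
    then show ?thesis
      using orthogonal_to_span[of s B "x - P x"] b by (auto simp: orthogonal_def)
  qed
  ultimately show ?thesis using that by blast
qed

locale orthogonal_projection =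
  fixes S :: "'a::euclidean_space set" and P :: "'a \<Rightarrow> 'a"
  assumes subsp: "subspace S" and lin: "linear P" and mem: "P x \<in> S"
    and perp: "s \<in> S \<Longrightarrow> (x - P x) \<bullet> s = 0"
begin

lemma dist_sq: "s \<in> S \<Longrightarrow> (norm (x - s))\<^sup>2 = (norm (x - P x))\<^sup>2 + (norm (P x - s))\<^sup>2"
proof -
  assume "s \<in> S"
  then have "P x - s \<in> S" using mem subsp by (simp add: subspace_diff)
  then have "orthogonal (x - P x) (P x - s)" using perp orthogonal_def by blast
  from norm_add_Pythagorean[OF this] show ?thesis by simp
qed

lemma pythagoras: "(norm x)\<^sup>2 = (norm (x - P x))\<^sup>2 + (norm (P x))\<^sup>2"
  using dist_sq[of 0 x] subsp by (simp add: subspace_0)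

lemma norm_proj_le: "norm (P x) \<le> norm x"
proof -
  have "(norm (P x))\<^sup>2 \<le> (norm x)\<^sup>2" using pythagoras[of x] by simp
  then show ?thesis by (rule power2_le_imp_le) simp
qed

lemma infdist_eq: "infdist x S = norm (x - P x)"
proof -
  have "norm (x - P x) \<le> dist x s" if "s \<in> S" for s
    unfolding dist_norm using dist_sq[OF that, of x] power2_le_imp_le[OF _ norm_ge_zero]
    by (metis le_add_same_cancel1 zero_le_power2)
  moreover have "S \<noteq> {}" using mem by auto
  ultimately have "norm (x - P x) \<le> infdist x S" by (simp add: infdist_def cINF_greatest)
  moreover have "infdist x S \<le> norm (x - P x)"
    using infdist_le[OF mem, of x x] by (simp add: dist_norm)
  ultimately show ?thesis by simp
qed

lemma null: "(\<And>s. s \<in> S \<Longrightarrow> x \<bullet> s = 0) \<Longrightarrow> P x = 0"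
proof -
  assume "\<And>s. s \<in> S \<Longrightarrow> x \<bullet> s = 0"
  then have "x \<bullet> P x = 0" using mem by blast
  moreover have "(x - P x) \<bullet> P x = 0" using mem perp by blast
  ultimately show ?thesis by (simp add: inner_diff_left)
qed

end

lemma orthogonal_projection_obtain:
  assumes "subspace S" obtains P where "orthogonal_projection S P"
  using orthogonal_projection_exists[OF assms] assms
  by (metis orthogonal_projection.intro)

text \<open>The residual \<open>x - P x\<close> is linear in \<open>x\<close>, so the distance to a
  subspace is a seminorm. Closeness of a vector to the fitted subspace \<open>H\<close> is later
  measured by this seminorm.\<close>

lemma infdist_subspace_add:
  fixes H :: "'a::euclidean_space set"
  assumes "subspace H" shows "infdist (x + y) H \<le> infdist x H + infdist y H"
proof -
  obtain P where "orthogonal_projection H P" using orthogonal_projection_obtain[OF assms] .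
  then interpret orthogonal_projection H P .
  have "x + y - P (x + y) = (x - P x) + (y - P y)" using lin by (simp add: linear_add)
  then show ?thesis
    unfolding infdist_eq using norm_triangle_ineq[of "x - P x" "y - P y"] by presburger
qed

lemma infdist_subspace_scale:
  fixes H :: "'a::euclidean_space set"
  assumes "subspace H" shows "infdist (c *\<^sub>R x) H = \<bar>c\<bar> * infdist x H"
proof -
  obtain P where "orthogonal_projection H P" using orthogonal_projection_obtain[OF assms] .
  then interpret orthogonal_projection H P .
  have "c *\<^sub>R x - P (c *\<^sub>R x) = c *\<^sub>R (x - P x)"
    using lin by (simp add: linear_scale scaleR_diff_right)
  then show ?thesis by (simp add: infdist_eq)
qed

lemma infdist_subspace_le_norm:
  fixes H :: "'a::euclidean_space set"
  assumes "subspace H" shows "infdist x H \<le> norm x"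
  using infdist_le[OF subspace_0[OF assms], of x] by simp

lemma infdist_subspace_sum:
  fixes H :: "'a::euclidean_space set"
  assumes "subspace H" "finite B"
  shows "infdist (\<Sum>b\<in>B. f b) H \<le> (\<Sum>b\<in>B. infdist (f b) H)"
  using assms(2)
proof (induction rule: finite_induct)
  case empty
  then show ?case using infdist_subspace_le_norm[OF assms(1), of 0] by simp
next
  case (insert b B)
  then show ?case using infdist_subspace_add[OF assms(1), of "f b" "sum f B"] by simp
qed

section \<open>Tangent spaces of embedded submanifolds\<close>

lemma Ck_on_imp_continuous_on: "Ck_on k f U \<Longrightarrow> continuous_on U f"
  by (cases k) (auto intro: differentiable_imp_continuous_within continuous_at_imp_continuous_on)

section \<open>Tangent vectors seen through one straightening chart\<close>

locale C1_chart =
  fixes S U V :: "'a::euclidean_space set" and \<phi> \<psi> :: "'a \<Rightarrow> 'a" and L :: "'a set"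
    and \<phi>' \<psi>' :: "'a \<Rightarrow> 'a \<Rightarrow> 'a"
  assumes openU: "open U" and openV: "open V"
    and \<phi>_mem: "x \<in> U \<Longrightarrow> \<phi> x \<in> V" and \<psi>_\<phi>: "x \<in> U \<Longrightarrow> \<psi> (\<phi> x) = x"
    and \<psi>_mem: "y \<in> V \<Longrightarrow> \<psi> y \<in> U" and \<phi>_\<psi>: "y \<in> V \<Longrightarrow> \<phi> (\<psi> y) = y"
    and subL: "subspace L" and image: "\<phi> ` (U \<inter> S) = V \<inter> L"
    and der\<phi>: "x \<in> U \<Longrightarrow> (\<phi> has_derivative \<phi>' x) (at x)"
    and der\<psi>: "y \<in> V \<Longrightarrow> (\<psi> has_derivative \<psi>' y) (at y)"
    and cont\<phi>: "continuous_on U (\<lambda>x. \<phi>' x v)" and cont\<psi>: "continuous_on V (\<lambda>y. \<psi>' y v)"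
begin

lemma linear\<phi>: "x \<in> U \<Longrightarrow> linear (\<phi>' x)" and linear\<psi>: "y \<in> V \<Longrightarrow> linear (\<psi>' y)"
  using der\<phi> der\<psi> has_derivative_linear by blast+

lemma \<psi>'_\<phi>': "x \<in> U \<Longrightarrow> \<psi>' (\<phi> x) (\<phi>' x u) = u"
proof -
  assume x: "x \<in> U"
  have "(\<psi> \<circ> \<phi> has_derivative \<psi>' (\<phi> x) \<circ> \<phi>' x) (at x)"
    using diff_chain_at[OF der\<phi>[OF x] der\<psi>[OF \<phi>_mem[OF x]]] .
  moreover have "(\<psi> \<circ> \<phi> has_derivative id) (at x)"
    by (rule has_derivative_transform_within_open[OF has_derivative_id openU x])
      (simp add: \<psi>_\<phi>)
  ultimately have "\<psi>' (\<phi> x) \<circ> \<phi>' x = id" by (rule has_derivative_unique)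
  then show ?thesis by (metis comp_apply id_apply)
qed

lemma \<phi>'_\<psi>': "x \<in> U \<Longrightarrow> \<phi>' x (\<psi>' (\<phi> x) l) = l"
proof -
  assume x: "x \<in> U"
  have "(\<phi> has_derivative \<phi>' x) (at (\<psi> (\<phi> x)))" using der\<phi>[OF x] \<psi>_\<phi>[OF x] by simp
  from diff_chain_at[OF der\<psi>[OF \<phi>_mem[OF x]] this]
  have "(\<phi> \<circ> \<psi> has_derivative \<phi>' x \<circ> \<psi>' (\<phi> x)) (at (\<phi> x))" .
  moreover have "(\<phi> \<circ> \<psi> has_derivative id) (at (\<phi> x))"
    by (rule has_derivative_transform_within_open[OF has_derivative_id openV \<phi>_mem[OF x]])
      (simp add: \<phi>_\<psi>)
  ultimately have "\<phi>' x \<circ> \<psi>' (\<phi> x) = id" by (rule has_derivative_unique)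
  then show ?thesis by (metis comp_apply id_apply)
qed

lemma \<phi>_in_L: "x \<in> U \<Longrightarrow> x \<in> S \<Longrightarrow> \<phi> x \<in> L"
  using image by blast

lemma \<psi>_in_S: "y \<in> V \<Longrightarrow> y \<in> L \<Longrightarrow> \<psi> y \<in> S"
proof -
  assume "y \<in> V" "y \<in> L"
  then obtain x where "x \<in> U" "x \<in> S" "y = \<phi> x" using image by blast
  then show ?thesis using \<psi>_\<phi> by simp
qed

text \<open>The difference quotients of \<open>\<phi> \<circ> \<gamma>\<close> at 0 eventually lie
  in \<open>L\<close>, and \<open>L\<close> is closed, so their limit stays in
  \<open>L\<close>.\<close>

lemma tangent_space_subset:
  assumes x: "x \<in> U" "x \<in> S" and v: "v \<in> tangent_space S x"
  shows "\<phi>' x v \<in> L"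
proof -
  obtain \<gamma> \<epsilon> where g: "\<epsilon> > 0" "\<gamma> ` {-\<epsilon><..<\<epsilon>} \<subseteq> S" "\<gamma> 0 = x" "(\<gamma> has_vector_derivative v) (at 0)"
    using v by (auto simp: tangent_space_def)
  have "(\<phi> has_derivative \<phi>' x) (at (\<gamma> 0))" using der\<phi>[OF x(1)] g(3) by simp
  from vector_derivative_diff_chain_within[OF g(4), of \<phi> "\<phi>' x"] this
  have "((\<phi> \<circ> \<gamma>) has_vector_derivative \<phi>' x v) (at 0)"
    using has_derivative_at_withinI by blast
  then have "((\<lambda>t. norm ((\<phi> \<circ> \<gamma>) (0 + t) - (\<phi> \<circ> \<gamma>) 0 - t *\<^sub>R \<phi>' x v) / norm t) \<longlongrightarrow> 0) (at 0)"
    unfolding has_vector_derivative_def has_derivative_at by blast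
  then have "((\<lambda>t. norm ((\<phi> (\<gamma> t) - \<phi> (\<gamma> 0)) /\<^sub>R t - \<phi>' x v)) \<longlongrightarrow> 0) (at 0)"
  proof (rule Lim_transform_eventually)
    have "norm (w - t *\<^sub>R z) / norm t = norm (w /\<^sub>R t - z)" if "t \<noteq> 0" for w z :: 'a and t :: real
    proof -
      have "w /\<^sub>R t - z = (w - t *\<^sub>R z) /\<^sub>R t" using that by (simp add: scaleR_diff_right)
      then show ?thesis by (simp add: divide_inverse mult.commute)
    qed
    then show "\<forall>\<^sub>F t in at 0. norm ((\<phi> \<circ> \<gamma>) (0 + t) - (\<phi> \<circ> \<gamma>) 0 - t *\<^sub>R \<phi>' x v) / norm t
        = norm ((\<phi> (\<gamma> t) - \<phi> (\<gamma> 0)) /\<^sub>R t - \<phi>' x v)"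
      by (auto simp: eventually_at_filter)
  qed
  from LIM_zero_cancel[OF tendsto_norm_zero_cancel[OF this]]
  have lim: "((\<lambda>t. (\<phi> (\<gamma> t) - \<phi> (\<gamma> 0)) /\<^sub>R t) \<longlongrightarrow> \<phi>' x v) (at 0)" .
  have "isCont \<gamma> 0" using g(4) by (simp add: has_vector_derivative_continuous)
  then have "(\<gamma> \<longlongrightarrow> x) (at 0)" using g(3) by (simp add: isCont_def)
  then have "\<forall>\<^sub>F t in at 0. \<gamma> t \<in> U" using openU x(1) topological_tendstoD by blast
  moreover have "\<forall>\<^sub>F t in at 0. t \<in> {-\<epsilon><..<\<epsilon>}"
    using g(1) by (intro eventually_at_in_open') auto
  ultimately have "\<forall>\<^sub>F t in at 0. (\<phi> (\<gamma> t) - \<phi> (\<gamma> 0)) /\<^sub>R t \<in> L"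
  proof eventually_elim
    case (elim t)
    then have "\<phi> (\<gamma> t) \<in> L" "\<phi> (\<gamma> 0) \<in> L" using g(2,3) x \<phi>_in_L by blast+
    then show ?case using subL by (simp add: subspace_scale subspace_diff)
  qed
  then show ?thesis
    using Lim_in_closed_set[OF closed_subspace[OF subL] _ _ lim] by simp
qed

text \<open>The required curve is the image under \<open>\<psi>\<close> of the straight line through
  \<open>\<phi> x\<close> in direction \<open>\<phi>' x u\<close>, which runs inside
  \<open>L\<close>.\<close>

lemma tangent_space_supset:
  assumes x: "x \<in> U" "x \<in> S" and u: "\<phi>' x u \<in> L"
  shows "u \<in> tangent_space S x"
proof -
  define c where "c = (\<lambda>t::real. \<phi> x + t *\<^sub>R \<phi>' x u)"
  have contc: "continuous_on UNIV c" unfolding c_def by (intro continuous_intros)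
  then have "open (c -` V)" using openV by (simp add: open_vimage)
  moreover have "0 \<in> c -` V" using \<phi>_mem x by (simp add: c_def)
  ultimately obtain \<epsilon> where e: "\<epsilon> > 0" "ball 0 \<epsilon> \<subseteq> c -` V" by (meson openE)
  have cV: "c t \<in> V" if "t \<in> {-\<epsilon><..<\<epsilon>}" for t using e(2) that by (auto simp: subset_eq dist_norm)
  have cL: "c t \<in> L" for t
    unfolding c_def using subL u \<phi>_in_L[OF x] by (simp add: subspace_add subspace_scale)
  have der: "((\<psi> \<circ> c) has_vector_derivative \<psi>' (c t) (\<phi>' x u)) (at t)" if "t \<in> {-\<epsilon><..<\<epsilon>}" for t
  proof -
    have "(c has_vector_derivative \<phi>' x u) (at t)"
      unfolding c_def by (auto intro!: derivative_eq_intros)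
    then show ?thesis
      using vector_derivative_diff_chain_within der\<psi>[OF cV[OF that]] has_derivative_at_withinI by blast
  qed
  have "continuous_on {-\<epsilon><..<\<epsilon>} (\<lambda>t. \<psi>' (c t) (\<phi>' x u))"
    by (rule continuous_on_compose2[OF cont\<psi> continuous_on_subset[OF contc]]) (use cV in auto)
  then have C1: "(\<psi> \<circ> c) C1_differentiable_on {-\<epsilon><..<\<epsilon>}"
    unfolding C1_differentiable_on_def
    by (intro exI[of _ "\<lambda>t. \<psi>' (c t) (\<phi>' x u)"] conjI ballI der)
  have "c 0 = \<phi> x" by (simp add: c_def)
  then have "((\<psi> \<circ> c) has_vector_derivative u) (at 0)" "(\<psi> \<circ> c) 0 = x"
    using der[of 0] e(1) \<psi>'_\<phi>'[OF x(1)] \<psi>_\<phi>[OF x(1)] by auto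
  moreover have "(\<psi> \<circ> c) ` {-\<epsilon><..<\<epsilon>} \<subseteq> S" using cV cL \<psi>_in_S by auto
  ultimately show ?thesis unfolding tangent_space_def using C1 e(1) by blast
qed

lemma tangent_space_eq:
  assumes "x \<in> U" "x \<in> S" shows "tangent_space S x = {u. \<phi>' x u \<in> L}"
  using tangent_space_subset[OF assms] tangent_space_supset[OF assms] by blast

lemma subspace_tangent_space: "x \<in> U \<Longrightarrow> x \<in> S \<Longrightarrow> subspace (tangent_space S x)"
  using linear_subspace_vimage[OF linear\<phi> subL, of x] by (simp add: tangent_space_eq vimage_def)

lemma dim_tangent_space: "x \<in> U \<Longrightarrow> x \<in> S \<Longrightarrow> dim (tangent_space S x) = dim L"
proof -
  assume x: "x \<in> U" "x \<in> S"
  have "tangent_space S x = \<psi>' (\<phi> x) ` L"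
    unfolding tangent_space_eq[OF x] using \<phi>'_\<psi>'[OF x(1)] \<psi>'_\<phi>'[OF x(1)]
    by (auto simp: image_iff) (metis)
  moreover have "inj (\<psi>' (\<phi> x))" by (rule inj_on_inverseI) (rule \<phi>'_\<psi>'[OF x(1)])
  ultimately show ?thesis
    using dim_image_eq[OF linear\<psi>[OF \<phi>_mem[OF x(1)]]] by (metis inj_on_subset subset_UNIV)
qed

text \<open>Closedness of the tangent bundle: tangency at \<open>q j\<close> means
  \<open>\<phi>' (q j) (u j) \<in> L\<close>, and this passes to the limit.\<close>

lemma tangent_space_limit:
  assumes p: "p \<in> U" "p \<in> S" and q: "\<And>j. q j \<in> S" "q \<longlonglongrightarrow> p"
    and u: "\<And>j. u j \<in> tangent_space S (q j)" "u \<longlonglongrightarrow> l"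
  shows "l \<in> tangent_space S p"
proof -
  have ev: "\<forall>\<^sub>F j in sequentially. q j \<in> U" using q(2) openU p(1) topological_tendstoD by blast
  \<comment> \<open>Continuity of the derivative is available only for a fixed direction, so the
    varying vector \<open>u j\<close> is expanded in \<open>Basis\<close>.\<close>
  have expand: "\<phi>' x v = (\<Sum>b\<in>Basis. (v \<bullet> b) *\<^sub>R \<phi>' x b)" if "x \<in> U" for x v
    using linear_sum[OF linear\<phi>[OF that], of "\<lambda>b. (v \<bullet> b) *\<^sub>R b" Basis]
    by (simp add: euclidean_representation linear_scale[OF linear\<phi>[OF that]])
  have "(\<lambda>j. \<Sum>b\<in>Basis. (u j \<bullet> b) *\<^sub>R \<phi>' (q j) b) \<longlonglongrightarrow> (\<Sum>b\<in>Basis. (l \<bullet> b) *\<^sub>R \<phi>' p b)"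
  proof (intro tendsto_sum tendsto_scaleR tendsto_inner u(2) tendsto_const)
    fix b
    have "isCont (\<lambda>x. \<phi>' x b) p" using cont\<phi> openU p(1) by (simp add: continuous_on_eq_continuous_at)
    then show "(\<lambda>j. \<phi>' (q j) b) \<longlonglongrightarrow> \<phi>' p b" using q(2) isCont_tendsto_compose by blast
  qed
  then have lim: "(\<lambda>j. \<Sum>b\<in>Basis. (u j \<bullet> b) *\<^sub>R \<phi>' (q j) b) \<longlonglongrightarrow> \<phi>' p l"
    unfolding expand[OF p(1), of l] .
  have "\<forall>\<^sub>F j in sequentially. (\<Sum>b\<in>Basis. (u j \<bullet> b) *\<^sub>R \<phi>' (q j) b) \<in> L"
    using ev
  proof eventually_elim
    case (elim j)
    then show ?case using expand[OF elim, of "u j"] tangent_space_subset[OF elim q(1) u(1)] by simp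
  qed
  from Lim_in_closed_set[OF closed_subspace[OF subL] this _ lim]
  show ?thesis using tangent_space_eq[OF p] by simp
qed

text \<open>Since \<open>\<phi> y - \<phi> p\<close> lies in \<open>L\<close>,
  \<open>\<psi>' (\<phi> p)\<close> maps it to a tangent vector at \<open>p\<close>. That vector
  differs from \<open>y - p\<close> only by the image of the linearisation error \<open>w\<close>,
  and this is all that \<open>n\<close> sees.\<close>

lemma normal_little_o:
  assumes p: "p \<in> U" "p \<in> S" and n: "\<And>v. v \<in> tangent_space S p \<Longrightarrow> n \<bullet> v = 0" and e: "e > 0"
  shows "\<exists>\<delta>>0. \<forall>y\<in>S. norm (y - p) < \<delta> \<longrightarrow> \<bar>n \<bullet> (y - p)\<bar> \<le> e * norm (y - p)"
proof -
  have lin: "linear (\<psi>' (\<phi> p))" using linear\<psi>[OF \<phi>_mem[OF p(1)]] .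
  then obtain B where B: "B > 0" "\<And>v. norm (\<psi>' (\<phi> p) v) \<le> B * norm v"
    using linear_bounded_pos by blast
  \<comment> \<open>The summand 1 keeps the denominator positive when \<open>n = 0\<close>.\<close>
  define e' where "e' = e / (B * (norm n + 1))"
  have e': "e' > 0" unfolding e'_def using e B(1) by (simp add: add_nonneg_pos)
  then obtain \<delta> where d: "\<delta> > 0"
      "\<And>y. norm (y - p) < \<delta> \<Longrightarrow> norm (\<phi> y - \<phi> p - \<phi>' p (y - p)) \<le> e' * norm (y - p)"
    using der\<phi>[OF p(1)] unfolding has_derivative_at_alt by blast
  obtain \<delta>' where d': "\<delta>' > 0" "ball p \<delta>' \<subseteq> U" using openU p(1) by (meson openE)
  have "\<bar>n \<bullet> (y - p)\<bar> \<le> e * norm (y - p)" if y: "y \<in> S" "norm (y - p) < min \<delta> \<delta>'" for y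
  proof -
    have "y \<in> U" using d'(2) y(2) by (auto simp: dist_norm norm_minus_commute)
    then have L: "\<phi> y - \<phi> p \<in> L" using y p \<phi>_in_L subL by (simp add: subspace_diff)
    define w where "w = \<phi> y - \<phi> p - \<phi>' p (y - p)"
    have "\<psi>' (\<phi> p) (\<phi> y - \<phi> p) \<in> tangent_space S p"
      using tangent_space_eq[OF p] L \<phi>'_\<psi>'[OF p(1)] by simp
    then have "n \<bullet> \<psi>' (\<phi> p) (\<phi> y - \<phi> p) = 0" using n by blast
    moreover have "\<psi>' (\<phi> p) (\<phi> y - \<phi> p) = \<psi>' (\<phi> p) w + (y - p)"
      using \<psi>'_\<phi>'[OF p(1), of "y - p"] linear_add[OF lin, of w "\<phi>' p (y - p)"] by (simp add: w_def)
    ultimately have "\<bar>n \<bullet> (y - p)\<bar> = \<bar>n \<bullet> \<psi>' (\<phi> p) w\<bar>" by (simp add: inner_add_right)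
    also have "\<dots> \<le> norm n * (B * norm w)"
      by (meson B(2) Cauchy_Schwarz_ineq2 mult_left_mono norm_ge_zero order_trans)
    also have "\<dots> \<le> (norm n + 1) * (B * (e' * norm (y - p)))"
      using d(2)[of y] y(2) B(1) unfolding w_def by (intro mult_mono mult_left_mono) auto
    also have "\<dots> = e * norm (y - p)" 
      using B(1) by (simp add: e'_def field_simps add_nonneg_eq_0_iff)
    finally show ?thesis .
  qed
  then show ?thesis using d(1) d'(1) by (intro exI[of _ "min \<delta> \<delta>'"]) auto
qed

end

lemma submanifold_C1_chart:
  fixes S :: "'a::euclidean_space set"
  assumes "submanifold k d S" "1 \<le> k" "p \<in> S"
  obtains U V \<phi> \<psi> L \<phi>' \<psi>' where "C1_chart S U V \<phi> \<psi> L \<phi>' \<psi>'" "p \<in> U" "dim L = d"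
proof -
  obtain U V \<psi> L and \<phi> :: "'a \<Rightarrow> 'a" where c: "open U \<and> p \<in> U \<and> open V \<and> homeomorphism U V \<phi> \<psi> \<and>
        Ck_on k \<phi> U \<and> Ck_on k \<psi> V \<and> subspace L \<and> dim L = d \<and> \<phi> ` (U \<inter> S) = V \<inter> L"
    using assms(1)[unfolded submanifold_def, rule_format, OF assms(3)] by blast
  obtain k' where k: "k = Suc k'" using assms(2) by (cases k) auto
  have "C1_chart S U V \<phi> \<psi> L (\<lambda>x. frechet_derivative \<phi> (at x)) (\<lambda>x. frechet_derivative \<psi> (at x))"
    using c unfolding k by unfold_locales
      (auto simp: homeomorphism_def frechet_derivative_works[symmetric] intro: Ck_on_imp_continuous_on)
  then show ?thesis using that c by blast
qed

locale C1_submanifold =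
  fixes S :: "'a::euclidean_space set" and d :: nat
  assumes chart: "p \<in> S \<Longrightarrow>
    \<exists>U V \<phi> \<psi> L \<phi>' \<psi>'. C1_chart S U V \<phi> \<psi> L \<phi>' \<psi>' \<and> p \<in> U \<and> dim L = d"
begin

lemma subspace_tangent: "p \<in> S \<Longrightarrow> subspace (tangent_space S p)"
  using chart C1_chart.subspace_tangent_space by metis

lemma dim_tangent: "p \<in> S \<Longrightarrow> dim (tangent_space S p) = d"
  using chart C1_chart.dim_tangent_space by metis

lemma tangent_limit:
  assumes "p \<in> S" "\<And>j. q j \<in> S" "q \<longlonglongrightarrow> p" "\<And>j. u j \<in> tangent_space S (q j)" "u \<longlonglongrightarrow> l"
  shows "l \<in> tangent_space S p"
proof -
  obtain U V \<phi> \<psi> L \<phi>' \<psi>' where "C1_chart S U V \<phi> \<psi> L \<phi>' \<psi>'" "p \<in> U"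
    using chart[OF assms(1)] by (elim exE conjE) (rule that, assumption+)
  then show ?thesis by (rule C1_chart.tangent_space_limit) (use assms in auto)
qed

lemma normal_approx:
  assumes "p \<in> S" "\<And>v. v \<in> tangent_space S p \<Longrightarrow> n \<bullet> v = 0" "e > 0"
  shows "\<exists>\<delta>>0. \<forall>y\<in>S. norm (y - p) < \<delta> \<longrightarrow> \<bar>n \<bullet> (y - p)\<bar> \<le> e * norm (y - p)"
proof -
  obtain U V \<phi> \<psi> L \<phi>' \<psi>' where "C1_chart S U V \<phi> \<psi> L \<phi>' \<psi>'" "p \<in> U"
    using chart[OF assms(1)] by (elim exE conjE) (rule that, assumption+)
  then show ?thesis by (rule C1_chart.normal_little_o) (use assms in auto)
qed

end

lemma submanifold_imp_C1: "submanifold k d S \<Longrightarrow> 1 \<le> k \<Longrightarrow> C1_submanifold S d"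
  by unfold_locales (metis submanifold_C1_chart)

text \<open>The squared distance from \<open>x\<close> along a curve in \<open>S\<close> through
  \<open>y\<close> is minimal at parameter 0, so its derivative vanishes there.\<close>

lemma nearest_imp_normal:
  assumes "y \<in> S" "\<And>z. z \<in> S \<Longrightarrow> dist x y \<le> dist x z" "u \<in> tangent_space S y"
  shows "(x - y) \<bullet> u = 0"
proof -
  obtain \<gamma> \<epsilon> where g: "\<epsilon> > 0" "\<gamma> ` {-\<epsilon><..<\<epsilon>} \<subseteq> S" "\<gamma> 0 = y" "(\<gamma> has_vector_derivative u) (at 0)"
    using assms(3) by (auto simp: tangent_space_def)
  have "((\<lambda>t. (x - \<gamma> t) \<bullet> (x - \<gamma> t)) has_derivative
      (\<lambda>h. (x - \<gamma> 0) \<bullet> (0 - h *\<^sub>R u) + (0 - h *\<^sub>R u) \<bullet> (x - \<gamma> 0))) (at 0)"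
    using g(4) unfolding has_vector_derivative_def by (intro derivative_intros)
  then have D: "((\<lambda>t. (x - \<gamma> t) \<bullet> (x - \<gamma> t)) has_field_derivative - 2 * ((x - y) \<bullet> u)) (at 0)"
    unfolding has_field_derivative_def
    by (rule has_derivative_eq_rhs) (auto simp: g(3) inner_commute)
  have "(x - \<gamma> 0) \<bullet> (x - \<gamma> 0) \<le> (x - \<gamma> t) \<bullet> (x - \<gamma> t)" if "\<bar>0 - t\<bar> < \<epsilon>" for t
  proof -
    have "\<gamma> t \<in> S" using g(2) that by (auto simp: image_subset_iff abs_less_iff)
    then have "norm (x - y) \<le> norm (x - \<gamma> t)" using assms(2) by (simp add: dist_norm)
    then show ?thesis using g(3) by (simp add: norm_le)
  qed
  then have "- 2 * ((x - y) \<bullet> u) = 0" using DERIV_local_min[OF D g(1)] by blast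
  then show ?thesis by simp
qed

section \<open>Normals of a set of positive reach\<close>

lemma norm_diff_scaleR_unit_sq:
  fixes n :: "'a::real_inner"
  assumes "norm n = 1" shows "(norm (x - t *\<^sub>R n))\<^sup>2 = (norm x)\<^sup>2 - 2 * t * (n \<bullet> x) + t\<^sup>2"
proof -
  have "n \<bullet> n = 1" using assms by (simp add: norm_eq_1)
  then show ?thesis
    unfolding power2_norm_eq_inner
    by (simp add: inner_diff_left inner_diff_right inner_commute power2_eq_square algebra_simps)
qed

lemma infdist_closest_point:
  assumes "closed S" "S \<noteq> {}" shows "infdist x S = dist x (closest_point S x)"
proof (rule antisym)
  show "infdist x S \<le> dist x (closest_point S x)"
    by (rule infdist_le) (rule closest_point_in_set[OF assms])
  show "dist x (closest_point S x) \<le> infdist x S"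
    unfolding infdist_notempty[OF assms(2)]
    by (rule cINF_greatest[OF assms(2)]) (rule closest_point_le[OF assms(1)])
qed

lemma unique_nearest_within_closest_point:
  assumes "unique_nearest_within S t" "closed S" "infdist x S < t" "p \<in> S" "dist x p \<le> infdist x S"
  shows "closest_point S x = p"
proof -
  have "S \<noteq> {}" using assms(4) by auto
  have "\<exists>!p. p \<in> S \<and> dist x p = infdist x S"
    using assms(1,3) unfolding unique_nearest_within_def by blast
  moreover have "dist x p = infdist x S" using assms(4,5) infdist_le by (metis antisym)
  ultimately show ?thesis
    using infdist_closest_point[OF assms(2) \<open>S \<noteq> {}\<close>] closest_point_in_set[OF assms(2) \<open>S \<noteq> {}\<close>] assms(4)
    by metis
qed

text \<open>If \<open>z j\<close> tends to \<open>x\<close>, a subsequential limit of the nearest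
  points realises the distance of \<open>x\<close> to \<open>S\<close>, hence is the unique nearest
  point. Compactness supplies such a limit. Brouwer's theorem below needs this continuity.\<close>

lemma continuous_on_closest_point_unique_nearest:
  fixes S :: "'a::euclidean_space set"
  assumes un: "unique_nearest_within S t" and S: "compact S" "S \<noteq> {}"
  shows "continuous_on {x. infdist x S < t} (closest_point S)"
proof -
  have cl: "closed S" using S compact_imp_closed by blast
  have "\<exists>\<delta>>0. \<forall>x'. dist x' x < \<delta> \<longrightarrow> dist (closest_point S x') (closest_point S x) < e"
    if x: "infdist x S < t" and e: "e > 0" for x e
  proof (rule ccontr)
    assume "\<not> ?thesis"
    then have "\<forall>j::nat. \<exists>x'. dist x' x < 1 / real (Suc j) \<and> dist (closest_point S x') (closest_point S x) \<ge> e"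
      by (metis divide_pos_pos of_nat_0_less_iff not_le zero_less_Suc zero_less_one)
    then obtain z where z: "\<And>j. dist (z j) x < 1 / real (Suc j)"
        "\<And>j. dist (closest_point S (z j)) (closest_point S x) \<ge> e" by metis
    have "(\<lambda>j. dist (z j) x) \<longlonglongrightarrow> 0"
      by (rule tendsto_sandwich[OF _ _ tendsto_const LIMSEQ_inverse_real_of_nat])
        (auto simp: inverse_eq_divide intro!: always_eventually less_imp_le z(1)[simplified])
    then have zx: "z \<longlonglongrightarrow> x" by (rule tendsto_dist_iff[THEN iffD2])
    have "\<forall>j. closest_point S (z j) \<in> S" using closest_point_in_set[OF cl S(2)] by blast
    then obtain l r where lr: "l \<in> S" "strict_mono r" "((\<lambda>j. closest_point S (z j)) \<circ> r) \<longlonglongrightarrow> l"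
      using S(1) unfolding compact_def by metis
    have zr: "(\<lambda>j. z (r j)) \<longlonglongrightarrow> x" using LIMSEQ_subseq_LIMSEQ[OF zx lr(2)] by (simp add: o_def)
    have pr: "(\<lambda>j. closest_point S (z (r j))) \<longlonglongrightarrow> l" using lr(3) by (simp add: o_def)
    have "(\<lambda>j. infdist (z (r j)) S) \<longlonglongrightarrow> dist x l"
      unfolding infdist_closest_point[OF cl S(2)] by (rule tendsto_dist[OF zr pr])
    moreover have "(\<lambda>j. infdist (z (r j)) S) \<longlonglongrightarrow> infdist x S" by (rule tendsto_infdist[OF zr])
    ultimately have "dist x l = infdist x S" using LIMSEQ_unique by blast
    then have "closest_point S x = l"
      using unique_nearest_within_closest_point[OF un cl x lr(1)] by simp
    then have "(\<lambda>j. dist (closest_point S (z (r j))) (closest_point S x)) \<longlonglongrightarrow> 0"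
      using tendsto_dist_iff[THEN iffD1, OF pr] by simp
    moreover have "\<forall>j\<ge>0. e \<le> dist (closest_point S (z (r j))) (closest_point S x)" using z(2) by blast
    ultimately have "e \<le> 0" using Lim_bounded2 by fastforce
    then show False using e by simp
  qed
  then show ?thesis unfolding continuous_on_iff by blast
qed

text \<open>A fixed point \<open>x\<close> of \<open>x \<mapsto> x\<^sub>0 + \<epsilon> (x - \<pi> x) / \<bar>x - \<pi> x\<bar>\<close>, which Brouwer's theorem provides,
  has \<open>x\<^sub>0\<close> on its segment to \<open>\<pi> x\<close>. Hence \<open>\<pi> x = \<pi> x\<^sub>0\<close>, and the segment from \<open>\<pi> x\<^sub>0\<close> to \<open>x\<^sub>0\<close>
  has been prolonged by \<open>\<epsilon>\<close>. This replaces the flow of the gradient of the distance function.\<close>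

lemma nearest_segment_extend:
  fixes S :: "'a::euclidean_space set"
  assumes un: "unique_nearest_within S t" and S: "compact S" "y \<in> S" and n: "norm n = 1"
    and s: "0 < s" "infdist (y + s *\<^sub>R n) S = s" and eps: "0 < \<epsilon>" "\<epsilon> \<le> s / 2" "s + \<epsilon> < t"
  shows "infdist (y + (s + \<epsilon>) *\<^sub>R n) S = s + \<epsilon>"
proof -
  define x0 where "x0 = y + s *\<^sub>R n"
  define \<pi> where "\<pi> = closest_point S"
  have S0: "S \<noteq> {}" and cl: "closed S" using S compact_imp_closed by blast+
  have inf: "infdist x S = dist x (\<pi> x)" for x
    unfolding \<pi>_def by (rule infdist_closest_point[OF cl S0])
  have \<pi>S: "\<pi> x \<in> S" for x unfolding \<pi>_def by (rule closest_point_in_set[OF cl S0])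
  have ball: "s - \<epsilon> \<le> infdist x S" "infdist x S < t" if "x \<in> cball x0 \<epsilon>" for x
  proof -
    have "\<bar>infdist x S - infdist x0 S\<bar> \<le> \<epsilon>"
      using infdist_triangle_abs[of x S x0] that by (simp add: dist_commute)
    then show "s - \<epsilon> \<le> infdist x S" "infdist x S < t" using s(2) eps(3) unfolding x0_def by linarith+
  qed
  define f where "f = (\<lambda>x. x0 + (\<epsilon> / dist x (\<pi> x)) *\<^sub>R (x - \<pi> x))"
  \<comment> \<open>The bound \<open>\<epsilon> \<le> s / 2\<close> enters here:
    \<open>s - \<epsilon> \<ge> \<epsilon>\<close>, so the denominator in \<open>f\<close> stays
    away from 0.\<close>
  have pos: "dist x (\<pi> x) \<ge> \<epsilon>" if "x \<in> cball x0 \<epsilon>" for x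
    using ball(1)[OF that] inf[of x] eps(2) by linarith
  have "continuous_on (cball x0 \<epsilon>) \<pi>"
    unfolding \<pi>_def by (rule continuous_on_subset[OF continuous_on_closest_point_unique_nearest[OF un S(1) S0]])
      (use ball(2) in auto)
  then have "continuous_on (cball x0 \<epsilon>) f"
    unfolding f_def using pos eps(1) by (intro continuous_intros) force+
  moreover have "f \<in> cball x0 \<epsilon> \<rightarrow> cball x0 \<epsilon>"
  proof
    fix x assume "x \<in> cball x0 \<epsilon>"
    then show "f x \<in> cball x0 \<epsilon>"
      using pos[of x] eps(1) by (auto simp: f_def dist_norm)
  qed
  ultimately obtain x where x: "x \<in> cball x0 \<epsilon>" "f x = x" using brouwer_ball[OF eps(1)] by blast
  define D where "D = dist x (\<pi> x)"
  have D: "D \<ge> \<epsilon>" "D > 0" using pos[OF x(1)] eps(1) by (auto simp: D_def)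
  have xx0: "x - x0 = (\<epsilon> / D) *\<^sub>R (x - \<pi> x)" using x(2) unfolding f_def D_def by (metis add_diff_cancel_left')
  have x0p: "x0 - \<pi> x = (1 - \<epsilon> / D) *\<^sub>R (x - \<pi> x)"
  proof -
    have "x0 - \<pi> x = (x - \<pi> x) - (x - x0)" by simp
    then show ?thesis unfolding xx0 by (simp add: scaleR_diff_left)
  qed
  have d0: "dist x0 (\<pi> x) = D - \<epsilon>"
  proof -
    have "dist x0 (\<pi> x) = (1 - \<epsilon> / D) * D"
      unfolding dist_norm x0p using D by (simp add: D_def dist_norm)
    then show ?thesis using D(2) by (simp add: left_diff_distrib)
  qed
  have "D - \<epsilon> \<le> infdist x0 S"
  proof -
    have "dist x x0 = \<epsilon>" unfolding dist_norm xx0 using D eps(1) by (simp add: D_def dist_norm)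
    then show ?thesis using infdist_triangle_abs[of x S x0] inf[of x] unfolding D_def by linarith
  qed
  moreover have "infdist x0 S = s" using s(2) by (simp add: x0_def)
  \<comment> \<open>The point \<open>x0\<close> has distance \<open>D - \<epsilon>\<close> from
    \<open>\<pi> x\<close> and at least this distance from \<open>S\<close>, so
    \<open>\<pi> x\<close> is a nearest point of \<open>x0\<close>.\<close>
  ultimately have \<pi>x0: "\<pi> x0 = \<pi> x" and Ds: "D - \<epsilon> = s"
  proof -
    show "\<pi> x0 = \<pi> x" unfolding \<pi>_def
      by (rule unique_nearest_within_closest_point[OF un cl])
        (use \<pi>S d0 \<open>D - \<epsilon> \<le> infdist x0 S\<close> \<open>infdist x0 S = s\<close> eps in \<open>auto simp: \<pi>_def\<close>)
    then show "D - \<epsilon> = s" using d0 inf[of x0] \<open>infdist x0 S = s\<close> by simp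
  qed
  have "\<pi> x0 = y" unfolding \<pi>_def
    by (rule unique_nearest_within_closest_point[OF un cl])
      (use S s eps n \<open>infdist x0 S = s\<close> in \<open>auto simp: x0_def dist_norm\<close>)
  then have py: "\<pi> x = y" using \<pi>x0 by simp
  have "s *\<^sub>R n = (s / D) *\<^sub>R (x - y)"
  proof -
    have "1 - \<epsilon> / D = s / D" using Ds D(2) by (simp add: field_simps)
    then show ?thesis using x0p py by (simp add: x0_def)
  qed
  then have "(1 / s) *\<^sub>R (s *\<^sub>R n) = (1 / s) *\<^sub>R ((s / D) *\<^sub>R (x - y))" by simp
  then have "n = (1 / D) *\<^sub>R (x - y)" using s(1) by simp
  then have "D *\<^sub>R n = x - y" using D(2) by simp
  then have "x = y + (s + \<epsilon>) *\<^sub>R n" using Ds by (simp add: algebra_simps)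
  moreover have "infdist x S = s + \<epsilon>" using inf[of x] Ds by (simp add: D_def)
  ultimately show ?thesis by simp
qed

text \<open>One extension lengthens the segment by a factor of up to 3/2, so finitely many reach any
  length below \<open>t\<close>.\<close>

lemma nearest_ray_extend:
  fixes S :: "'a::euclidean_space set"
  assumes un: "unique_nearest_within S t" and S: "compact S" "y \<in> S" and n: "norm n = 1"
    and s: "0 < s" "infdist (y + s *\<^sub>R n) S = s" and s': "s \<le> s'" "s' < t"
  shows "infdist (y + s' *\<^sub>R n) S = s'"
proof -
  have "s \<le> s' \<Longrightarrow> s' \<le> (3/2) ^ k * s \<Longrightarrow> s' < t \<Longrightarrow> infdist (y + s' *\<^sub>R n) S = s'" for k s'
  proof (induction k arbitrary: s')
    case 0
    then have "s' = s" by simp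
    then show ?case using s(2) by simp
  next
    case (Suc k)
    \<comment> \<open>Two thirds of the target, but not below \<open>s\<close>: the remaining gap
      \<open>s' - a\<close> is then at most \<open>a / 2\<close>, as one extension requires.\<close>
    define a where "a = max s (s' * (2/3))"
    have a: "s \<le> a" "a \<le> s'" "s' - a \<le> a / 2"
      using Suc.prems s(1) by (auto simp: a_def max_def)
    have "s' * (2/3) \<le> (3/2) ^ k * s" using Suc.prems(2) by simp
    moreover have "s \<le> (3/2) ^ k * s" using s(1) by simp
    ultimately have "a \<le> (3/2) ^ k * s" unfolding a_def by simp
    then have *: "infdist (y + a *\<^sub>R n) S = a" using Suc.IH[of a] a Suc.prems by simp
    show ?case
    proof (cases "a = s'")
      case True then show ?thesis using * by simp
    next
      case False
      then show ?thesis
        using nearest_segment_extend[OF un S n _ *, of "s' - a"] a s(1) Suc.prems(3) by simp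
    qed
  qed
  moreover obtain k where "s' / s < (3/2) ^ k" using real_arch_pow[of "3/2" "s' / s"] by auto
  then have "s' \<le> (3/2) ^ k * s" using s(1) by (simp add: field_simps)
  ultimately show ?thesis using s' by blast
qed

text \<open>The reach is a supremum, which directly yields uniqueness for \<open>t < \<tau>\<close>;
  estimates with \<open>\<tau>\<close> itself are obtained by letting \<open>t\<close> tend to
  \<open>\<tau>\<close>.\<close>

locale reach_submanifold = C1_submanifold S d for S :: "'a::euclidean_space set" and d +
  fixes \<tau> :: real
  assumes compactS: "compact S" and nonempty: "S \<noteq> {}" and \<tau>_pos: "\<tau> > 0"
    and unique: "t < \<tau> \<Longrightarrow> unique_nearest_within S t"
begin

lemma closedS: "closed S" using compactS compact_imp_closed by blast

definition normal :: "'a \<Rightarrow> 'a \<Rightarrow> bool"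
  where "normal p n \<longleftrightarrow> (\<forall>v\<in>tangent_space S p. n \<bullet> v = 0)"

lemma normal_scale: "normal p n \<Longrightarrow> normal p (c *\<^sub>R n)"
  by (simp add: normal_def)

lemma infdist_eq: "infdist x S = dist x (closest_point S x)"
  by (rule infdist_closest_point[OF closedS nonempty])

lemma closest_mem: "closest_point S x \<in> S"
  by (rule closest_point_in_set[OF closedS nonempty])

lemma closest_le: "z \<in> S \<Longrightarrow> norm (x - closest_point S x) \<le> norm (x - z)"
  using closest_point_le[OF closedS] by (simp add: dist_norm)

lemma normal_closest: "normal (closest_point S x) (x - closest_point S x)"
  unfolding normal_def using nearest_imp_normal closest_mem closest_point_le[OF closedS] by blast

text \<open>After prolonging the segment along \<open>w\<close> to length \<open>t\<close>, the open
  ball of radius \<open>t\<close> about its end misses \<open>S\<close>. Expanding the squared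
  distance from \<open>x\<close> to that centre gives the inequality, so far only when
  \<open>y\<close> is known to be nearest to \<open>y + w\<close>.\<close>

lemma proximal_ball:
  assumes t: "0 < t" "t < \<tau>" and w: "w \<noteq> 0" "norm w \<le> t" and y: "y \<in> S" "infdist (y + w) S = norm w"
    and x: "x \<in> S"
  shows "w \<bullet> (x - y) \<le> norm w * (norm (x - y))\<^sup>2 / (2 * t)"
proof -
  define n where "n = w /\<^sub>R norm w"
  have n: "norm n = 1" "w = norm w *\<^sub>R n" using w by (simp_all add: n_def)
  \<comment> \<open>The extension reaches only lengths strictly below the uniqueness threshold,
    hence the midpoint of \<open>t\<close> and \<open>\<tau>\<close>.\<close>
  have "infdist (y + t *\<^sub>R n) S = t"
    using nearest_ray_extend[OF unique[of "(t + \<tau>) / 2"] compactS y(1) n(1), of "norm w" t] t w y(2) n(2)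
    by simp
  then have "t \<le> norm ((y + t *\<^sub>R n) - x)" using infdist_le[OF x, of "y + t *\<^sub>R n"] by (simp add: dist_norm)
  then have "t\<^sup>2 \<le> (norm ((x - y) - t *\<^sub>R n))\<^sup>2"
    using t(1) by (intro power_mono) (simp_all add: norm_minus_commute algebra_simps)
  also have "\<dots> = (norm (x - y))\<^sup>2 - 2 * t * (n \<bullet> (x - y)) + t\<^sup>2"
    by (rule norm_diff_scaleR_unit_sq[OF n(1)])
  finally have "n \<bullet> (x - y) \<le> (norm (x - y))\<^sup>2 / (2 * t)" using t(1) by (simp add: field_simps)
  then have "norm w * (n \<bullet> (x - y)) \<le> norm w * ((norm (x - y))\<^sup>2 / (2 * t))"
    by (rule mult_left_mono) simp
  then show ?thesis using n(2) by (metis inner_scaleR_left times_divide_eq_right)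
qed

text \<open>Points \<open>p + s n\<close> with small \<open>s\<close> project to points \<open>y\<close> with \<open>\<bar>y - p\<bar> = o(s)\<close>, so that \<open>n\<close> is a
  limit of directions to which \<open>proximal_ball\<close> applies.\<close>

lemma normal_ball_approx:
  assumes p: "p \<in> S" and n: "normal p n" "norm n = 1" and t: "0 < t" "t < \<tau>" and e: "0 < e" "e < 1/4"
  shows "\<exists>y v. y \<in> S \<and> norm (y - p) \<le> 2 * e \<and> norm v \<le> 2 * e \<and>
    (\<forall>x\<in>S. (n + v) \<bullet> (x - y) \<le> norm (n + v) * (norm (x - y))\<^sup>2 / (2 * t))"
proof -
  obtain \<delta> where \<delta>: "\<delta> > 0" "\<And>y. y \<in> S \<Longrightarrow> norm (y - p) < \<delta> \<Longrightarrow> \<bar>n \<bullet> (y - p)\<bar> \<le> e * norm (y - p)"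
    using normal_approx[OF p _ e(1), of n] n(1) unfolding normal_def by blast
  \<comment> \<open>The three bounds on \<open>s\<close> give \<open>2 * s < \<delta>\<close> for
    the little-o property, \<open>norm w \<le> t\<close> for \<open>proximal_ball\<close>, and
    \<open>2 * s * e \<le> 2 * e\<close> at the end.\<close>
  define s where "s = min (min (\<delta> / 4) t) 1"
  have s: "0 < s" "s \<le> 1" "s \<le> t" "2 * s < \<delta>" using \<delta>(1) t(1) by (auto simp: s_def min_def)
  define y where "y = closest_point S (p + s *\<^sub>R n)"
  have y: "y \<in> S" using closest_mem by (simp add: y_def)
  have le: "norm (p + s *\<^sub>R n - y) \<le> s"
    using closest_le[OF p, of "p + s *\<^sub>R n"] n(2) s(1) by (simp add: y_def)
  have "norm (y - p) \<le> norm (s *\<^sub>R n) + norm (p + s *\<^sub>R n - y)"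
    using norm_triangle_ineq4[of "s *\<^sub>R n" "p + s *\<^sub>R n - y"] by (simp add: algebra_simps)
  then have "norm (y - p) \<le> 2 * s" using le n(2) s(1) by simp
  then have o: "n \<bullet> (y - p) \<le> e * norm (y - p)" using \<delta>(2)[OF y] s(4) by fastforce
  have "(norm (p + s *\<^sub>R n - y))\<^sup>2 \<le> s\<^sup>2" using le by (intro power_mono) auto
  moreover have "(norm (p + s *\<^sub>R n - y))\<^sup>2 = (norm (y - p))\<^sup>2 - 2 * s * (n \<bullet> (y - p)) + s\<^sup>2"
    using norm_diff_scaleR_unit_sq[OF n(2), of "y - p" s] norm_minus_commute[of "p + s *\<^sub>R n" y]
    by (simp add: diff_diff_eq)
  \<comment> \<open>The point \<open>y\<close> is at least as close to
    \<open>p + s *\<^sub>R n\<close> as \<open>p\<close> is; expanded, this bounds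
    \<open>norm (y - p)\<close> quadratically by a term that the little-o property makes
    small.\<close>
  ultimately have "(norm (y - p))\<^sup>2 \<le> 2 * s * (n \<bullet> (y - p))" by simp
  also have "\<dots> \<le> 2 * s * (e * norm (y - p))" using o s(1) by simp
  finally have "norm (y - p) * norm (y - p) \<le> (2 * s * e) * norm (y - p)"
    by (simp add: power2_eq_square mult.assoc)
  then have yp: "norm (y - p) \<le> 2 * s * e"
    using s(1) e(1) by (cases "norm (y - p) = 0") (auto simp: mult_le_cancel_right)
  define v where "v = (p - y) /\<^sub>R s"
  have "norm v = norm (y - p) / s"
    using s(1) by (simp add: v_def norm_minus_commute divide_inverse mult.commute)
  then have v: "norm v \<le> 2 * e" using yp s(1) by (simp add: pos_divide_le_eq mult_ac)
  define w where "w = p + s *\<^sub>R n - y"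
  have w: "w = s *\<^sub>R (n + v)" using s(1) by (simp add: w_def v_def scaleR_add_right)
  have "norm (n + v) \<ge> 1 - 2 * e" using norm_diff_ineq[of n v] n(2) v by linarith
  then have nz: "norm (n + v) > 0" using e(2) by linarith
  have "(n + v) \<bullet> (x - y) \<le> norm (n + v) * (norm (x - y))\<^sup>2 / (2 * t)" if x: "x \<in> S" for x
  proof -
    have "w \<bullet> (x - y) \<le> norm w * (norm (x - y))\<^sup>2 / (2 * t)"
    proof (rule proximal_ball[OF t _ _ y _ x])
      show "w \<noteq> 0" using nz s(1) w by auto
      show "norm w \<le> t" using le s(3) by (simp add: w_def)
      show "infdist (y + w) S = norm w"
        unfolding infdist_eq by (simp add: w_def y_def dist_norm)
    qed
    then have "s * ((n + v) \<bullet> (x - y)) \<le> s * (norm (n + v) * (norm (x - y))\<^sup>2 / (2 * t))"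
      unfolding w using s(1) by (simp add: mult.assoc)
    then show ?thesis using s(1) by (simp only: mult_le_cancel_left_pos)
  qed
  moreover have "2 * s * e \<le> 2 * e" using s(2) e(1) by simp
  ultimately show ?thesis using y v yp by (meson order_trans)
qed

text \<open>Two limits: \<open>e\<close> tends to 0 in \<open>normal_ball_approx\<close> for fixed
  \<open>t\<close>, then \<open>t\<close> tends to \<open>\<tau>\<close> from below.\<close>

lemma normal_ball_unit:
  assumes p: "p \<in> S" and n: "normal p n" "norm n = 1" and x: "x \<in> S"
  shows "n \<bullet> (x - p) \<le> (norm (x - p))\<^sup>2 / (2 * \<tau>)"
proof -
  have t: "n \<bullet> (x - p) \<le> (norm (x - p))\<^sup>2 / (2 * t)" if t: "0 < t" "t < \<tau>" for t
  proof -
    define e where "e = (\<lambda>j::nat. inverse (real (Suc (j + 4))))"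
    have "e j < 1/4" "0 < e j" for j by (auto simp: e_def field_simps)
    then have "\<exists>y v. y \<in> S \<and> norm (y - p) \<le> 2 * e j \<and> norm v \<le> 2 * e j \<and>
        (\<forall>x\<in>S. (n + v) \<bullet> (x - y) \<le> norm (n + v) * (norm (x - y))\<^sup>2 / (2 * t))" for j
      using normal_ball_approx[OF p n t] by blast
    then obtain y v where yv: "\<And>j. norm (y j - p) \<le> 2 * e j" "\<And>j. norm (v j) \<le> 2 * e j"
        "\<And>j. (n + v j) \<bullet> (x - y j) \<le> norm (n + v j) * (norm (x - y j))\<^sup>2 / (2 * t)"
      using x by metis
    have "(\<lambda>j. inverse (real (Suc j))) \<longlonglongrightarrow> 0" by (rule LIMSEQ_inverse_real_of_nat)
    then have "e \<longlonglongrightarrow> 0" unfolding e_def by (rule LIMSEQ_ignore_initial_segment)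
    then have e: "(\<lambda>j. 2 * e j) \<longlonglongrightarrow> 0" using tendsto_mult_right_zero by blast
    have "(\<lambda>j. y j - p) \<longlonglongrightarrow> 0" "v \<longlonglongrightarrow> 0"
      using yv by (auto intro: Lim_null_comparison[OF _ e])
    then have y: "y \<longlonglongrightarrow> p" and v: "v \<longlonglongrightarrow> 0" using LIM_zero_cancel by blast+
    have "(\<lambda>j. (n + v j) \<bullet> (x - y j)) \<longlonglongrightarrow> (n + 0) \<bullet> (x - p)" by (intro tendsto_intros y v)
    moreover have "(\<lambda>j. norm (n + v j) * (norm (x - y j))\<^sup>2 / (2 * t))
        \<longlonglongrightarrow> norm (n + 0) * (norm (x - p))\<^sup>2 / (2 * t)"
      using t by (intro tendsto_intros y v) auto
    ultimately have "(n + 0) \<bullet> (x - p) \<le> norm (n + 0) * (norm (x - p))\<^sup>2 / (2 * t)"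
      using yv(3) LIMSEQ_le by blast
    then show ?thesis using n(2) by simp
  qed
  have "((\<lambda>t. (norm (x - p))\<^sup>2 / (2 * t)) \<longlongrightarrow> (norm (x - p))\<^sup>2 / (2 * \<tau>)) (at_left \<tau>)"
    using \<tau>_pos by (intro tendsto_intros) auto
  moreover have "\<forall>\<^sub>F t in at_left \<tau>. n \<bullet> (x - p) \<le> (norm (x - p))\<^sup>2 / (2 * t)"
    using eventually_at_left_real[OF \<tau>_pos] by eventually_elim (use t in auto)
  ultimately show ?thesis using tendsto_lowerbound trivial_limit_at_left_real by blast
qed

lemma normal_ball:
  assumes p: "p \<in> S" and n: "normal p n" and x: "x \<in> S"
  shows "n \<bullet> (x - p) \<le> norm n * ((norm (x - p))\<^sup>2 / (2 * \<tau>))"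
proof (cases "n = 0")
  case False
  then have "(n /\<^sub>R norm n) \<bullet> (x - p) \<le> (norm (x - p))\<^sup>2 / (2 * \<tau>)"
    using normal_ball_unit[OF p normal_scale[OF n] _ x, of "inverse (norm n)"] by simp
  then show ?thesis using False by (simp add: field_simps)
qed simp

text \<open>The inequality is preserved under limits of both \<open>p\<close> and \<open>n\<close>,
  which yields closedness of the normal bundle. Conversely, the inequality makes \<open>p\<close> a
  nearest point of \<open>p + \<tau> *\<^sub>R n\<close>, so \<open>n\<close> is normal.\<close>

lemma normal_iff:
  assumes "p \<in> S" "norm n = 1"
  shows "normal p n \<longleftrightarrow> (\<forall>x\<in>S. n \<bullet> (x - p) \<le> (norm (x - p))\<^sup>2 / (2 * \<tau>))"
proof
  assume *: "\<forall>x\<in>S. n \<bullet> (x - p) \<le> (norm (x - p))\<^sup>2 / (2 * \<tau>)"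
  have near: "dist (p + \<tau> *\<^sub>R n) p \<le> dist (p + \<tau> *\<^sub>R n) x" if "x \<in> S" for x
  proof -
    have "(norm (p + \<tau> *\<^sub>R n - x))\<^sup>2 = (norm (x - p))\<^sup>2 - 2 * \<tau> * (n \<bullet> (x - p)) + \<tau>\<^sup>2"
      using norm_diff_scaleR_unit_sq[OF assms(2), of "x - p" \<tau>] norm_minus_commute[of "p + \<tau> *\<^sub>R n" x]
      by (simp add: diff_diff_eq)
    moreover have "2 * \<tau> * (n \<bullet> (x - p)) \<le> (norm (x - p))\<^sup>2"
      using *[rule_format, OF that] \<tau>_pos by (simp add: field_simps)
    ultimately have "\<tau>\<^sup>2 \<le> (norm (p + \<tau> *\<^sub>R n - x))\<^sup>2" by simp
    then have "\<tau> \<le> norm (p + \<tau> *\<^sub>R n - x)" by (rule power2_le_imp_le) simp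
    then show ?thesis using assms(2) \<tau>_pos by (simp add: dist_norm)
  qed
  have "n \<bullet> v = 0" if "v \<in> tangent_space S p" for v
  proof -
    have "(p + \<tau> *\<^sub>R n - p) \<bullet> v = 0" using assms(1) near that by (rule nearest_imp_normal)
    then show ?thesis using \<tau>_pos by simp
  qed
  then show "normal p n" unfolding normal_def by blast
qed (use normal_ball_unit assms in blast)

end

lemma reach_submanifoldI:
  fixes S :: "'a::euclidean_space set"
  assumes "submanifold k d S" "1 \<le> k" "compact S" "S \<noteq> {}" "reach S = ereal \<tau>" "\<tau> > 0"
  shows "reach_submanifold S d \<tau>"
proof -
  have un: "unique_nearest_within S t" if "t < \<tau>" for t
  proof -
    have "ereal t < Sup {ereal t |t. unique_nearest_within S t}"
      using assms(5) that unfolding reach_def by simp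
    then obtain t' where "unique_nearest_within S t'" "t < t'" unfolding less_Sup_iff by auto
    then show ?thesis unfolding unique_nearest_within_def using order_less_trans by blast
  qed
  interpret C1_submanifold S d using submanifold_imp_C1 assms by blast
  show ?thesis using assms un by unfold_locales auto
qed

section \<open>Variation of the tangent space\<close>

context reach_submanifold
begin

text \<open>This says \<open>K a \<le> \<kappa>\<close> for the function \<open>K\<close> of the
  overview; the sine is tested on unit normals because \<open>normal_ball\<close> speaks about
  normals.\<close>

definition tangent_variation :: "real \<Rightarrow> real \<Rightarrow> bool"
  where "tangent_variation a \<kappa> \<longleftrightarrow> (\<forall>p\<in>S. \<forall>m\<in>S. \<forall>u\<in>tangent_space S p. \<forall>n.
    norm (p - m) \<le> a \<longrightarrow> normal m n \<longrightarrow> norm u = 1 \<longrightarrow> norm n = 1 \<longrightarrow> n \<bullet> u \<le> \<kappa>)"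

text \<open>Counterexamples at scales tending to 0 would subconverge to a tangent vector and a
  normal at one common point whose inner product is at least \<open>e\<close>.\<close>

lemma tangent_variation_small:
  assumes e: "e > 0" shows "\<exists>a>0. tangent_variation a e"
proof (rule ccontr)
  assume "\<not> ?thesis"
  then have "\<not> tangent_variation (inverse (real (Suc j))) e" for j
    using positive_imp_inverse_positive[of "real (Suc j)"] by auto
  then have "\<forall>j. \<exists>p m u n. p \<in> S \<and> m \<in> S \<and> u \<in> tangent_space S p \<and> normal m n \<and> norm u = 1 \<and>
      norm n = 1 \<and> norm (p - m) \<le> inverse (real (Suc j)) \<and> n \<bullet> u > e"
    unfolding tangent_variation_def by (meson not_le)
  then obtain p m u n where *: "\<And>j. p j \<in> S \<and> m j \<in> S \<and> u j \<in> tangent_space S (p j) \<and> normal (m j) (n j) \<and>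
      norm (u j) = 1 \<and> norm (n j) = 1 \<and> norm (p j - m j) \<le> inverse (real (Suc j)) \<and> n j \<bullet> u j > e"
    by metis
  have "compact (S \<times> sphere (0::'a) 1 \<times> sphere (0::'a) 1)"
    using compactS by (intro compact_Times) auto
  then have sub: "(\<forall>j. f j \<in> S \<times> sphere (0::'a) 1 \<times> sphere (0::'a) 1) \<longrightarrow>
      (\<exists>l\<in>S \<times> sphere 0 1 \<times> sphere 0 1. \<exists>r. strict_mono r \<and> (f \<circ> r) \<longlonglongrightarrow> l)" for f :: "nat \<Rightarrow> 'a \<times> 'a \<times> 'a"
    unfolding compact_def by blast
  have "\<forall>j. (m j, u j, n j) \<in> S \<times> sphere 0 1 \<times> sphere 0 1" using * by simp
  with sub[of "\<lambda>j. (m j, u j, n j)"] obtain l r where l: "l \<in> S \<times> sphere (0::'a) 1 \<times> sphere (0::'a) 1" "strict_mono (r::nat\<Rightarrow>nat)"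
      "((\<lambda>j. (m j, u j, n j)) \<circ> r) \<longlonglongrightarrow> l"
    by blast
  obtain m0 u0 n0 where l0: "l = (m0, u0, n0)" by (cases l)
  have lim: "(\<lambda>j. m (r j)) \<longlonglongrightarrow> m0" "(\<lambda>j. u (r j)) \<longlonglongrightarrow> u0" "(\<lambda>j. n (r j)) \<longlonglongrightarrow> n0"
    using tendsto_fst[OF l(3)] tendsto_snd[OF l(3)] tendsto_fst[OF tendsto_snd[OF l(3)]]
      tendsto_snd[OF tendsto_snd[OF l(3)]] by (simp_all add: l0 o_def)
  have m0: "m0 \<in> S" "norm n0 = 1" using l(1) l0 by auto
  have "(\<lambda>j. p j - m j) \<longlonglongrightarrow> 0"
    using * by (intro Lim_null_comparison[OF _ LIMSEQ_inverse_real_of_nat]) auto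
  from LIMSEQ_subseq_LIMSEQ[OF this l(2)] have "(\<lambda>j. p (r j) - m (r j)) \<longlonglongrightarrow> 0" by (simp add: o_def)
  from tendsto_add[OF this lim(1)] have "(\<lambda>j. p (r j)) \<longlonglongrightarrow> m0" by simp
  then have u0: "u0 \<in> tangent_space S m0"
    using tangent_limit[OF m0(1), of "\<lambda>j. p (r j)" "\<lambda>j. u (r j)"] * lim(2) by blast
  have "n0 \<bullet> (x - m0) \<le> (norm (x - m0))\<^sup>2 / (2 * \<tau>)" if "x \<in> S" for x
  proof (rule LIMSEQ_le)
    show "(\<lambda>j. n (r j) \<bullet> (x - m (r j))) \<longlonglongrightarrow> n0 \<bullet> (x - m0)" by (intro tendsto_intros lim)
    show "(\<lambda>j. (norm (x - m (r j)))\<^sup>2 / (2 * \<tau>)) \<longlonglongrightarrow> (norm (x - m0))\<^sup>2 / (2 * \<tau>)"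
      using \<tau>_pos by (intro tendsto_intros lim) auto
    show "\<exists>N. \<forall>j\<ge>N. n (r j) \<bullet> (x - m (r j)) \<le> (norm (x - m (r j)))\<^sup>2 / (2 * \<tau>)"
      using * normal_ball_unit that by blast
  qed
  then have "normal m0 n0" using normal_iff m0 by blast
  then have "n0 \<bullet> u0 = 0" using u0 unfolding normal_def by blast
  moreover have "(\<lambda>j. n (r j) \<bullet> u (r j)) \<longlonglongrightarrow> n0 \<bullet> u0" by (intro tendsto_intros lim)
  ultimately have "e \<le> 0" using * by (intro Lim_bounded2[of _ 0 0 e]) (auto intro: less_imp_le)
  then show False using e by simp
qed

text \<open>The residual \<open>w\<close> is normal at the nearest point \<open>y\<close>. Pairing
  it with \<open>p - y = w - s *\<^sub>R u\<close> bounds \<open>w \<bullet> w\<close> by a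
  \<open>normal_ball\<close> term plus \<open>s * (w \<bullet> u)\<close>; the variation bound
  controls the latter, and one factor \<open>norm w\<close> cancels.\<close>

lemma infdist_tangent_line_le:
  assumes tv: "tangent_variation (2 * s) \<kappa>" "0 \<le> \<kappa>" and p: "p \<in> S"
    and u: "u \<in> tangent_space S p" "norm u = 1" and s: "0 \<le> s"
  shows "infdist (p + s *\<^sub>R u) S \<le> s * \<kappa> + 2 * s\<^sup>2 / \<tau>"
proof -
  define y where "y = closest_point S (p + s *\<^sub>R u)"
  define w where "w = p + s *\<^sub>R u - y"
  have y: "y \<in> S" using closest_mem by (simp add: y_def)
  have inf: "infdist (p + s *\<^sub>R u) S = norm w" by (simp add: infdist_eq y_def w_def dist_norm)
  show ?thesis
  proof (cases "w = 0")
    case True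
    then show ?thesis using inf tv(2) s \<tau>_pos by simp
  next
    case False
    have nw: "normal y w" using normal_closest[of "p + s *\<^sub>R u"] by (simp add: w_def y_def)
    have ws: "norm w \<le> s" using closest_le[OF p, of "p + s *\<^sub>R u"] u(2) s by (simp add: w_def y_def)
    have "p - y = w - s *\<^sub>R u" by (simp add: w_def)
    then have "norm (p - y) \<le> norm w + norm (s *\<^sub>R u)" by (metis norm_triangle_ineq4)
    then have py: "norm (p - y) \<le> 2 * s" using ws u(2) s by simp
    have "normal y (w /\<^sub>R norm w)" "norm (w /\<^sub>R norm w) = 1" using nw False by (auto intro: normal_scale)
    then have "(w /\<^sub>R norm w) \<bullet> u \<le> \<kappa>"
      using tv(1) p y u py unfolding tangent_variation_def by blast
    then have wu: "w \<bullet> u \<le> norm w * \<kappa>" using False by (simp add: field_simps)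
    have "w \<bullet> (p - y) \<le> norm w * ((norm (p - y))\<^sup>2 / (2 * \<tau>))" by (rule normal_ball[OF y nw p])
    also have "\<dots> \<le> norm w * ((2 * s)\<^sup>2 / (2 * \<tau>))"
      using py \<tau>_pos by (intro mult_left_mono divide_right_mono power_mono) auto
    also have "\<dots> = norm w * (2 * s\<^sup>2 / \<tau>)" by (simp add: power2_eq_square)
    finally have "w \<bullet> w - s * (w \<bullet> u) \<le> norm w * (2 * s\<^sup>2 / \<tau>)"
      unfolding \<open>p - y = w - s *\<^sub>R u\<close> by (simp add: inner_diff_right)
    moreover have "s * (w \<bullet> u) \<le> s * (norm w * \<kappa>)" using wu s by (rule mult_left_mono)
    ultimately have "norm w * norm w \<le> norm w * (s * \<kappa> + 2 * s\<^sup>2 / \<tau>)"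
      by (simp add: distrib_left norm_eq_sqrt_inner mult.left_commute)
    then show ?thesis using False inf by (simp add: mult_le_cancel_left_pos)
  qed
qed

text \<open>A normal at \<open>m\<close> is tested on \<open>y\<close>, a point of \<open>S\<close>
  close to \<open>p + s *\<^sub>R u\<close>, and its negative on \<open>p\<close>; the sum isolates
  \<open>s * (n \<bullet> u)\<close>.\<close>

lemma tangent_variation_double:
  assumes tv: "tangent_variation (a / 2) \<kappa>" "0 \<le> \<kappa>" and a: "0 < a"
  shows "tangent_variation a (\<kappa> + 7 * a / \<tau>)"
  unfolding tangent_variation_def
proof (intro ballI allI impI)
  fix p m u n
  assume p: "p \<in> S" and m: "m \<in> S" and u: "u \<in> tangent_space S p" "norm u = 1" and pm: "norm (p - m) \<le> a"
    and n: "normal m n" "norm n = 1"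
  \<comment> \<open>With this \<open>s\<close>, \<open>infdist_tangent_line_le\<close> uses the
    variation at scale \<open>2 * s = a / 2\<close>, where it is already known.\<close>
  define s where "s = a / 4"
  define y where "y = closest_point S (p + s *\<^sub>R u)"
  define e where "e = p + s *\<^sub>R u - y"
  have y: "y \<in> S" using closest_mem by (simp add: y_def)
  have s: "0 \<le> s" using a by (simp add: s_def)
  have "norm e = infdist (p + s *\<^sub>R u) S" by (simp add: infdist_eq y_def e_def dist_norm)
  then have en: "norm e \<le> s * \<kappa> + 2 * s\<^sup>2 / \<tau>"
    using infdist_tangent_line_le[of s \<kappa> p u] tv p u s by (simp add: s_def)
  have "norm e \<le> s" using closest_le[OF p, of "p + s *\<^sub>R u"] u(2) s by (simp add: e_def y_def)
  moreover have "y - m = (p - m) + (s *\<^sub>R u - e)" by (simp add: e_def)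
  then have "norm (y - m) \<le> norm (p - m) + (norm (s *\<^sub>R u) + norm e)"
    by (metis add_left_mono norm_triangle_ineq norm_triangle_ineq4 order_trans)
  ultimately have ym: "norm (y - m) \<le> 3 / 2 * a" using pm u(2) s by (simp add: s_def)
  have "n \<bullet> (y - m) \<le> (norm (y - m))\<^sup>2 / (2 * \<tau>)" by (rule normal_ball_unit[OF m n y])
  also have "\<dots> \<le> (3 / 2 * a)\<^sup>2 / (2 * \<tau>)"
    using ym \<tau>_pos by (intro divide_right_mono power_mono) auto
  finally have 1: "n \<bullet> (y - m) \<le> 9 / 8 * a\<^sup>2 / \<tau>" by (simp add: power2_eq_square)
  have "normal m (- n)" using normal_scale[OF n(1), of "-1"] by simp
  then have "(- n) \<bullet> (p - m) \<le> (norm (p - m))\<^sup>2 / (2 * \<tau>)" using normal_ball_unit[OF m _ _ p, of "- n"] n(2) by simp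
  also have "\<dots> \<le> a\<^sup>2 / (2 * \<tau>)" using pm \<tau>_pos by (intro divide_right_mono power_mono) auto
  finally have 2: "- (n \<bullet> (p - m)) \<le> 1 / 2 * a\<^sup>2 / \<tau>" by simp
  have 3: "n \<bullet> e \<le> s * \<kappa> + 2 * s\<^sup>2 / \<tau>" using norm_cauchy_schwarz[of n e] n(2) en by simp
  have "s *\<^sub>R u = (y - m) + e - (p - m)" by (simp add: e_def)
  then have "s * (n \<bullet> u) = n \<bullet> (y - m) + n \<bullet> e - n \<bullet> (p - m)"
    by (metis inner_add_right inner_diff_right inner_scaleR_right)
  also have "\<dots> \<le> 9 / 8 * a\<^sup>2 / \<tau> + (s * \<kappa> + 2 * s\<^sup>2 / \<tau>) + 1 / 2 * a\<^sup>2 / \<tau>" using 1 2 3 by linarith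
  \<comment> \<open>Dividing the terms in \<open>a\<^sup>2 / \<tau>\<close> and
    \<open>2 * s\<^sup>2 / \<tau>\<close> by \<open>s = a / 4\<close> gives the coefficients 9/2 +
    1/2 + 2 = 7.\<close>
  also have "\<dots> = s * (\<kappa> + 7 * a / \<tau>)"
    using \<tau>_pos by (simp add: s_def field_simps power2_eq_square)
  finally show "n \<bullet> u \<le> \<kappa> + 7 * a / \<tau>" using a by (simp add: s_def)
qed

text \<open>Halving the scale costs \<open>7 * a / \<tau>\<close>, and the geometric series sums to
  14. The start, at a scale below \<open>a0\<close>, contributes an arbitrary \<open>e > 0\<close>,
  which is finally removed.\<close>

lemma tangent_variation_bound:
  assumes "0 < a" shows "tangent_variation a (14 * a / \<tau>)"
proof -
  have "tangent_variation a (e + 14 * a / \<tau>)" if e: "e > 0" for e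
  proof -
    obtain a0 where a0: "a0 > 0" "tangent_variation a0 e" using tangent_variation_small[OF e] by blast
    have "0 < a \<Longrightarrow> a / 2 ^ k \<le> a0 \<Longrightarrow> tangent_variation a (e + 14 * a / \<tau>)" for k a
    proof (induction k arbitrary: a)
      case 0
      have "0 \<le> 14 * a / \<tau>" using 0 \<tau>_pos by simp
      then have "tangent_variation a0 (e + 14 * a / \<tau>)"
        using a0(2) unfolding tangent_variation_def by fastforce
      then show ?case using 0 unfolding tangent_variation_def by fastforce
    next
      case (Suc k)
      have "tangent_variation (a / 2) (e + 14 * (a / 2) / \<tau>)"
        using Suc.prems by (intro Suc.IH) simp_all
      then have "tangent_variation a (e + 14 * (a / 2) / \<tau> + 7 * a / \<tau>)"
        using Suc.prems e \<tau>_pos by (intro tangent_variation_double) auto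
      moreover have "e + 14 * (a / 2) / \<tau> + 7 * a / \<tau> = e + 14 * a / \<tau>"
        using \<tau>_pos by (simp add: field_simps)
      ultimately show ?case by (simp only:)
    qed
    moreover obtain k where "a / a0 < 2 ^ k" using real_arch_pow[of 2 "a / a0"] by auto
    then have "a / 2 ^ k \<le> a0" using a0(1) by (simp add: field_simps)
    ultimately show ?thesis using assms by blast
  qed
  then show ?thesis
    unfolding tangent_variation_def using field_le_epsilon by (metis add.commute)
qed

section \<open>Quadratic closeness of the submanifold and its tangent spaces\<close>

lemma infdist_tangent_unit_le:
  assumes "p \<in> S" "u \<in> tangent_space S p" "norm u = 1" "0 < s"
  shows "infdist (p + s *\<^sub>R u) S \<le> 30 * s\<^sup>2 / \<tau>"
proof -
  \<comment> \<open>The variation at scale \<open>2 * s\<close> contributes 28, the curvature term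
    2.\<close>
  have "infdist (p + s *\<^sub>R u) S \<le> s * (14 * (2 * s) / \<tau>) + 2 * s\<^sup>2 / \<tau>"
    using assms \<tau>_pos by (intro infdist_tangent_line_le tangent_variation_bound) auto
  also have "\<dots> = 30 * s\<^sup>2 / \<tau>" using \<tau>_pos by (simp add: field_simps power2_eq_square)
  finally show ?thesis .
qed

lemma infdist_tangent_le:
  assumes "p \<in> S" "v \<in> tangent_space S p"
  shows "infdist (p + v) S \<le> 30 * (norm v)\<^sup>2 / \<tau>"
proof (cases "v = 0")
  case False
  have "v /\<^sub>R norm v \<in> tangent_space S p"
    using assms subspace_tangent[OF assms(1)] by (simp add: subspace_scale)
  then show ?thesis
    using infdist_tangent_unit_le[OF assms(1), of "v /\<^sub>R norm v" "norm v"] False by simp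
qed (use assms in simp)

text \<open>The residual \<open>w\<close> of the projection is itself normal at \<open>p\<close>,
  and \<open>w \<bullet> (x - p) = w \<bullet> w\<close>; so \<open>normal_ball\<close> for
  \<open>w\<close> bounds its length.\<close>

lemma infdist_tangent_space_le:
  assumes p: "p \<in> S" and x: "x \<in> S"
  shows "infdist (x - p) (tangent_space S p) \<le> (norm (x - p))\<^sup>2 / (2 * \<tau>)"
proof -
  obtain P where "orthogonal_projection (tangent_space S p) P"
    using orthogonal_projection_obtain[OF subspace_tangent[OF p]] .
  then interpret P: orthogonal_projection "tangent_space S p" P .
  define w where "w = x - p - P (x - p)"
  have "normal p w" unfolding normal_def w_def using P.perp by blast
  then have "w \<bullet> (x - p) \<le> norm w * ((norm (x - p))\<^sup>2 / (2 * \<tau>))" by (rule normal_ball[OF p _ x])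
  moreover have "w \<bullet> P (x - p) = 0" unfolding w_def using P.perp P.mem by blast
  then have "w \<bullet> (x - p) = w \<bullet> w" by (simp add: w_def inner_diff_right)
  ultimately have "norm w * norm w \<le> norm w * ((norm (x - p))\<^sup>2 / (2 * \<tau>))"
    by (simp add: power2_norm_eq_inner[symmetric] power2_eq_square)
  then have "norm w \<le> (norm (x - p))\<^sup>2 / (2 * \<tau>)"
    using \<tau>_pos by (cases "w = 0") (simp, meson mult_left_le_imp_le zero_less_norm_iff)
  then show ?thesis by (simp add: P.infdist_eq w_def)
qed

lemma infdist_tangent_spaces_le:
  assumes p: "p \<in> S" and m: "m \<in> S" and u: "u \<in> tangent_space S p" "norm u = 1"
  shows "infdist u (tangent_space S m) \<le> 14 * norm (p - m) / \<tau>"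
proof (cases "p = m")
  case True
  then show ?thesis using u by simp
next
  case False
  obtain P where "orthogonal_projection (tangent_space S m) P"
    using orthogonal_projection_obtain[OF subspace_tangent[OF m]] .
  then interpret P: orthogonal_projection "tangent_space S m" P .
  define w where "w = u - P u"
  show ?thesis
  proof (cases "w = 0")
    case True
    then show ?thesis using \<tau>_pos by (simp add: P.infdist_eq w_def)
  next
    case w: False
    have "normal m w" unfolding normal_def w_def using P.perp by blast
    then have "normal m (w /\<^sub>R norm w)" "norm (w /\<^sub>R norm w) = 1" using w by (auto intro: normal_scale)
    then have "(w /\<^sub>R norm w) \<bullet> u \<le> 14 * norm (p - m) / \<tau>"
      using tangent_variation_bound[of "norm (p - m)"] False p m u unfolding tangent_variation_def by fastforce
    moreover have "w \<bullet> P u = 0" unfolding w_def using P.perp P.mem by blast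
    then have "w \<bullet> u = w \<bullet> w" by (simp add: w_def inner_diff_right)
    then have "(w /\<^sub>R norm w) \<bullet> u = norm w"
      using w by (simp add: power2_norm_eq_inner[symmetric] power2_eq_square)
    ultimately show ?thesis by (simp add: P.infdist_eq w_def)
  qed
qed

end

section \<open>Principal angles\<close>

text \<open>The Taylor bound \<open>sin x \<ge> x - x ^ 3 / 6\<close> suffices because
  \<open>x\<^sup>2 \<le> 3\<close> on this range.\<close>

lemma half_le_sin:
  assumes "0 \<le> x" "x \<le> pi / 2" shows "x / 2 \<le> sin x"
proof -
  have "(\<Sum>m<3. sin_coeff m * x ^ m) = x"
    by (simp add: numeral_eq_Suc sin_coeff_def)
  then have "\<bar>sin x - x\<bar> \<le> x ^ 3 / 6"
    using Maclaurin_sin_bound[of x 3] assms(1) by (simp add: fact_numeral field_simps)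
  moreover have "x ^ 3 / 6 \<le> x / 2"
  proof -
    have "pi \<le> 33 / 10" using pi_approx(2) by simp
    then have "x \<le> 33 / 20" using assms(2) by linarith
    then have "x\<^sup>2 \<le> (33 / 20)\<^sup>2" using assms(1) by (rule power_mono)
    then have "x * x\<^sup>2 \<le> x * 3" using assms(1) by (intro mult_left_mono) (auto simp: power2_eq_square)
    then show ?thesis by (simp add: power3_eq_cube power2_eq_square)
  qed
  ultimately show ?thesis by linarith
qed

lemma arccos_le_of_sq:
  assumes "0 \<le> \<kappa>" "\<kappa> < 1" "0 \<le> c" "c \<le> 1" "1 - \<kappa>\<^sup>2 \<le> c\<^sup>2"
  shows "arccos c \<le> 2 * \<kappa>"
proof -
  have b: "0 \<le> arccos c" "arccos c \<le> pi / 2"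
    using assms arccos_lbound[of c] arccos_le_pi2[of c] by auto
  have "sin (arccos c) = sqrt (1 - c\<^sup>2)" using assms by (intro sin_arccos) auto
  also have "\<dots> \<le> sqrt (\<kappa>\<^sup>2)" using assms(5) by (intro real_sqrt_le_mono) simp
  also have "\<dots> = \<kappa>" using assms(1) by simp
  finally show ?thesis using half_le_sin[OF b] by simp
qed

lemma abs_inner_le_1: "norm x = 1 \<Longrightarrow> norm y = 1 \<Longrightarrow> \<bar>x \<bullet> y\<bar> \<le> 1"
  using Cauchy_Schwarz_ineq2[of x y] by simp

text \<open>If \<open>a\<close> had a component \<open>c\<close> along a unit vector
  \<open>z\<close> of \<open>V\<close> orthogonal to \<open>w\<close>, the normalised combination of
  \<open>w\<close> and \<open>z\<close> would attain \<open>sqrt (s\<^sup>2 + c\<^sup>2)\<close>,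
  which exceeds the maximum \<open>s\<close>.\<close>

lemma unit_maximizer_orthogonal:
  fixes V :: "'a::real_inner set"
  assumes V: "subspace V" and w: "w \<in> V" "norm w = 1" and max: "\<And>y. y \<in> V \<Longrightarrow> norm y = 1 \<Longrightarrow> a \<bullet> y \<le> a \<bullet> w"
    and x: "x \<in> V" "x \<bullet> w = 0"
  shows "a \<bullet> x = 0"
proof (rule ccontr)
  assume ax: "a \<bullet> x \<noteq> 0"
  then have x0: "x \<noteq> 0" by auto
  define z where "z = x /\<^sub>R norm x"
  have z: "z \<in> V" "norm z = 1" "z \<bullet> w = 0" "a \<bullet> z \<noteq> 0"
    using x x0 ax V by (auto simp: z_def subspace_scale)
  define s where "s = a \<bullet> w"
  define c where "c = a \<bullet> z"
  define r where "r = sqrt (s\<^sup>2 + c\<^sup>2)"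
  have r: "r\<^sup>2 = s\<^sup>2 + c\<^sup>2" "r > 0" using z(4) by (auto simp: r_def c_def sum_power2_gt_zero_iff)
  define y where "y = s *\<^sub>R w + c *\<^sub>R z"
  have "y \<bullet> y = s\<^sup>2 * (w \<bullet> w) + c\<^sup>2 * (z \<bullet> z) + 2 * s * c * (z \<bullet> w)"
    by (simp add: y_def inner_add_left inner_add_right inner_commute power2_eq_square algebra_simps)
  then have "y \<bullet> y = r\<^sup>2" using z w r(1) by (simp add: norm_eq_1)
  then have "norm y = r" using r(2) by (simp add: norm_eq_sqrt_inner)
  moreover have "y \<in> V" using V w z by (simp add: y_def subspace_add subspace_scale)
  ultimately have "a \<bullet> (y /\<^sub>R r) \<le> s"
    unfolding s_def using r(2) V by (intro max) (auto simp: subspace_scale)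
  moreover have "a \<bullet> y = r\<^sup>2" using r(1) by (simp add: y_def s_def c_def inner_add_right power2_eq_square)
  then have "a \<bullet> (y /\<^sub>R r) = r" using r(2) by (simp add: power2_eq_square)
  ultimately have "r \<le> s" by simp
  then have "r\<^sup>2 \<le> s\<^sup>2" using r(2) by (intro power_mono) auto
  then show False using r(1) z(4) by (simp add: c_def)
qed

section \<open>Existence of principal vectors and bounds on their angles\<close>

lemma subspace_orthogonal_to:
  assumes "subspace V" shows "subspace {x \<in> V. \<forall>j<i. orthogonal x (u j)}"
  using assms unfolding subspace_def
  by (auto simp: orthogonal_def inner_add_left)

text \<open>One stage of \<open>principal_vectors\<close>, with the new pair as separate arguments
  so that the stages can be constructed one after another.\<close>

definition principal_pair ::
    "'a::euclidean_space set \<Rightarrow> 'a set \<Rightarrow> (nat \<Rightarrow> 'a) \<Rightarrow> (nat \<Rightarrow> 'a) \<Rightarrow> nat \<Rightarrow> 'a \<Rightarrow> 'a \<Rightarrow> bool"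
  where "principal_pair U W u w i x y \<longleftrightarrow>
    is_arg_min (\<lambda>(x, y). arccos (x \<bullet> y))
      (\<lambda>(x, y). x \<in> U \<and> y \<in> W \<and> norm x = 1 \<and> norm y = 1 \<and>
         (\<forall>j<i. orthogonal x (u j) \<and> orthogonal y (w j))) (x, y)"

text \<open>Since \<open>arccos\<close> is decreasing, minimising the angle means maximising the
  inner product.\<close>

lemma principal_pair_iff:
  "principal_pair U W u w i x y \<longleftrightarrow>
    x \<in> {x \<in> U. \<forall>j<i. orthogonal x (u j)} \<and> y \<in> {y \<in> W. \<forall>j<i. orthogonal y (w j)} \<and>
    norm x = 1 \<and> norm y = 1 \<and>
    (\<forall>x'\<in>{x \<in> U. \<forall>j<i. orthogonal x (u j)}. \<forall>y'\<in>{y \<in> W. \<forall>j<i. orthogonal y (w j)}.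
      norm x' = 1 \<longrightarrow> norm y' = 1 \<longrightarrow> x' \<bullet> y' \<le> x \<bullet> y)"
  unfolding principal_pair_def is_arg_min_linorder
  by (auto simp: arccos_le_mono[OF abs_inner_le_1 abs_inner_le_1] cong: conj_cong)

lemma principal_vectors_iff:
  "principal_vectors U W u w \<longleftrightarrow> (\<forall>i<dim U. principal_pair U W u w i (u i) (w i))"
  by (simp add: principal_vectors_def principal_pair_def)

lemma unit_orthogonal_exists:
  fixes V :: "'a::euclidean_space set"
  assumes "subspace V" "i < dim V" "\<And>j. j < i \<Longrightarrow> u j \<in> V"
  shows "\<exists>x\<in>{x \<in> V. \<forall>j<i. orthogonal x (u j)}. norm x = 1"
proof -
  have "dim (u ` {..<i}) \<le> i"
    using dim_le_card'[of "u ` {..<i}"] card_image_le[of "{..<i}" u] by simp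
  moreover have "span (u ` {..<i}) \<subseteq> span V" using assms(3) by (intro span_mono) auto
  ultimately have "span (u ` {..<i}) \<subset> span V"
    using assms(2) by (metis dim_span leD psubsetI)
  then obtain x where x: "x \<noteq> 0" "x \<in> span V" "\<And>y. y \<in> span (u ` {..<i}) \<Longrightarrow> orthogonal x y"
    using orthogonal_to_subspace_exists_gen by blast
  have "x /\<^sub>R norm x \<in> V" using x(2) assms(1) by (metis span_eq_iff subspace_scale)
  moreover have "orthogonal (x /\<^sub>R norm x) (u j)" if "j < i" for j
    using x(3)[OF span_base[of "u j"]] that by (simp add: orthogonal_def)
  ultimately show ?thesis using x(1) by (intro bexI[of _ "x /\<^sub>R norm x"]) auto
qed

text \<open>The admissible unit pairs form a compact set, nonempty because \<open>i\<close> earlier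
  vectors cannot span a space of dimension above \<open>i\<close>.\<close>

lemma principal_pair_exists:
  fixes U W :: "'a::euclidean_space set"
  assumes "subspace U" "subspace W" "i < dim U" "i < dim W" "\<And>j. j < i \<Longrightarrow> u j \<in> U \<and> w j \<in> W"
  shows "\<exists>x y. principal_pair U W u w i x y"
proof -
  define U' where "U' = {x \<in> U. \<forall>j<i. orthogonal x (u j)}"
  define W' where "W' = {x \<in> W. \<forall>j<i. orthogonal x (w j)}"
  have sub: "subspace U'" "subspace W'" unfolding U'_def W'_def using assms subspace_orthogonal_to by blast+
  define K where "K = (U' \<inter> sphere 0 1) \<times> (W' \<inter> sphere 0 1)"
  have "compact K" unfolding K_def
    using closed_subspace[OF sub(1)] closed_subspace[OF sub(2)]
    by (intro compact_Times closed_Int_compact) auto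
  moreover have "K \<noteq> {}"
    using unit_orthogonal_exists[of U i u] unit_orthogonal_exists[of W i w] assms
    by (auto simp: K_def U'_def W'_def)
  moreover have "continuous_on K (\<lambda>(x, y). x \<bullet> y)"
    unfolding case_prod_beta by (intro continuous_intros)
  ultimately obtain z where z: "z \<in> K" "\<forall>z'\<in>K. (case z' of (x, y) \<Rightarrow> x \<bullet> y) \<le> (case z of (x, y) \<Rightarrow> x \<bullet> y)"
    using continuous_attains_sup by blast
  obtain x y where xy: "z = (x, y)" by (cases z)
  have "principal_pair U W u w i x y"
    unfolding principal_pair_iff U'_def[symmetric] W'_def[symmetric]
    using z by (auto simp: K_def xy)
  then show ?thesis by blast
qed

lemma principal_pair_cong:
  assumes "\<And>j. j < i \<Longrightarrow> u j = u' j \<and> w j = w' j"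
  shows "principal_pair U W u w i x y = principal_pair U W u' w' i x y"
  unfolding principal_pair_iff using assms by auto

lemma principal_vectors_exist:
  fixes U W :: "'a::euclidean_space set"
  assumes "subspace U" "subspace W" "dim U = dim W"
  shows "\<exists>u w. principal_vectors U W u w"
proof -
  have "i \<le> dim U \<Longrightarrow> \<exists>u w. \<forall>k<i. principal_pair U W u w k (u k) (w k)" for i
  proof (induction i)
    case (Suc i)
    then obtain u w where uw: "\<forall>k<i. principal_pair U W u w k (u k) (w k)" by auto
    have "\<exists>x y. principal_pair U W u w i x y"
      by (rule principal_pair_exists) (use assms Suc.prems uw in \<open>auto simp: principal_pair_iff\<close>)
    then obtain x y where xy: "principal_pair U W u w i x y" by blast
    \<comment> \<open>Stage \<open>k\<close> looks only at vectors with index below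
      \<open>k\<close>, so the update at \<open>i\<close> leaves it valid.\<close>
    have "principal_pair U W (u(i := x)) (w(i := y)) k ((u(i := x)) k) ((w(i := y)) k)" if "k < Suc i" for k
    proof -
      have "principal_pair U W u w k ((u(i := x)) k) ((w(i := y)) k)"
        using uw xy that by (cases "k = i") auto
      then show ?thesis using that by (subst principal_pair_cong[of k _ u _ w]) auto
    qed
    then show ?case by blast
  qed simp
  then show ?thesis unfolding principal_vectors_iff by blast
qed

text \<open>The projection to \<open>U\<close> of a vector of \<open>W\<close> orthogonal to \<open>w 0, \<dots>, w (i - 1)\<close> is orthogonal to
  \<open>u 0, \<dots>, u (i - 1)\<close>, because \<open>w j\<close> maximises the inner product with \<open>u j\<close>. So the \<open>i\<close>-th
  principal angle is at most the angle between a vector of \<open>W\<close> and its projection.\<close>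

lemma principal_vectors_arccos_le:
  fixes U W :: "'a::euclidean_space set"
  assumes U: "subspace U" and W: "subspace W" and \<kappa>: "0 \<le> \<kappa>" "\<kappa> < 1"
    and near: "\<And>y. y \<in> W \<Longrightarrow> norm y = 1 \<Longrightarrow> infdist y U \<le> \<kappa>"
    and pv: "principal_vectors U W u w" and i: "i < dim U"
  shows "arccos (u i \<bullet> w i) \<le> 2 * \<kappa>"
proof -
  have pp: "principal_pair U W u w j (u j) (w j)" if "j \<le> i" for j
    using pv i that unfolding principal_vectors_iff by simp
  obtain P where "orthogonal_projection U P" using orthogonal_projection_obtain[OF U] .
  then interpret P: orthogonal_projection U P .
  define y where "y = w i"
  have y: "y \<in> W" "norm y = 1" "\<And>j. j < i \<Longrightarrow> orthogonal y (w j)"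
    using pp[of i] by (auto simp: y_def principal_pair_iff)
  have uy: "u j \<bullet> y = 0" if j: "j < i" for j
  proof (rule unit_maximizer_orthogonal[OF subspace_orthogonal_to[OF W, of j w]])
    show "w j \<in> {y \<in> W. \<forall>k<j. orthogonal y (w k)}" "norm (w j) = 1"
      using pp[of j] j by (auto simp: principal_pair_iff)
    show "u j \<bullet> y' \<le> u j \<bullet> w j" if "y' \<in> {y \<in> W. \<forall>k<j. orthogonal y (w k)}" "norm y' = 1" for y'
      using pp[of j] j that unfolding principal_pair_iff by auto
    show "y \<in> {y \<in> W. \<forall>k<j. orthogonal y (w k)}" using y j by auto
    show "y \<bullet> w j = 0" using y(3)[OF j] by (simp add: orthogonal_def)
  qed
  have "norm (y - P y) \<le> \<kappa>" using near[OF y(1,2)] by (simp add: P.infdist_eq)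
  then have "(norm (y - P y))\<^sup>2 \<le> \<kappa>\<^sup>2" by (intro power_mono) auto
  then have n2: "1 - \<kappa>\<^sup>2 \<le> (norm (P y))\<^sup>2" using P.pythagoras[of y] y(2) by simp
  moreover have "\<kappa>\<^sup>2 < 1" using \<kappa> by (simp add: power_less_one_iff abs_square_less_1)
  ultimately have pos: "norm (P y) > 0" by (metis diff_gt_0_iff_gt less_le_trans norm_eq_zero zero_less_norm_iff zero_power2 less_irrefl)
  define x where "x = P y /\<^sub>R norm (P y)"
  have "orthogonal (P y) (u j)" if "j < i" for j
  proof -
    have "u j \<in> U" using pp[of j] that by (simp add: principal_pair_iff)
    then have "(y - P y) \<bullet> u j = 0" by (rule P.perp)
    then show ?thesis using uy[OF that] by (simp add: orthogonal_def inner_diff_left inner_commute[of y])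
  qed
  then have x: "x \<in> {x \<in> U. \<forall>j<i. orthogonal x (u j)}" "norm x = 1"
    using pos P.mem U by (auto simp: x_def subspace_scale orthogonal_def)
  moreover have "y \<in> {y \<in> W. \<forall>j<i. orthogonal y (w j)}" using y by blast
  ultimately have le: "x \<bullet> y \<le> u i \<bullet> w i" using pp[of i] y(2) unfolding principal_pair_iff by blast
  have "(y - P y) \<bullet> P y = 0" using P.perp P.mem by blast
  then have "P y \<bullet> y = (norm (P y))\<^sup>2" by (simp add: inner_diff_left inner_commute[of y "P y"] power2_norm_eq_inner)
  then have xy: "x \<bullet> y = norm (P y)" using pos by (simp add: x_def power2_eq_square)
  have "norm (P y) \<le> 1" using P.norm_proj_le[of y] y(2) by simp
  then have "arccos (norm (P y)) \<le> 2 * \<kappa>" using \<kappa> n2 by (intro arccos_le_of_sq) auto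
  moreover have "\<bar>u i \<bullet> w i\<bar> \<le> 1"
    using pp[of i] by (intro abs_inner_le_1) (auto simp: principal_pair_iff)
  then have "arccos (u i \<bullet> w i) \<le> arccos (norm (P y))"
    using le xy order_trans[OF _ norm_ge_zero, of "-1" "P y"] by (intro arccos_le_arccos) auto
  ultimately show ?thesis by simp
qed

text \<open>The choice of principal vectors behind \<open>SOME\<close> is unknown, so the bound is
  used for every choice, and existence shows that the chosen value comes from one.\<close>

lemma max_principal_angle_le:
  fixes U W :: "'a::euclidean_space set"
  assumes "subspace U" "subspace W" "dim U = dim W" "0 < dim U" "0 \<le> \<kappa>" "\<kappa> < 1"
    and "\<And>y. y \<in> W \<Longrightarrow> norm y = 1 \<Longrightarrow> infdist y U \<le> \<kappa>"
  shows "max_principal_angle U W \<le> 2 * \<kappa>"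
proof -
  have "\<exists>\<theta> u w. principal_vectors U W u w \<and> \<theta> = Max ((\<lambda>i. arccos (u i \<bullet> w i)) ` {..<dim U})"
    using principal_vectors_exist[OF assms(1-3)] by blast
  from someI_ex[OF this] obtain u w where uw: "principal_vectors U W u w"
      "max_principal_angle U W = Max ((\<lambda>i. arccos (u i \<bullet> w i)) ` {..<dim U})"
    unfolding max_principal_angle_def by blast
  have "{..<dim U} \<noteq> {}" using assms(4) by auto
  then show ?thesis
    unfolding uw(2) using principal_vectors_arccos_le[OF assms(1,2,5,6,7) uw(1)]
    by (intro Max.boundedI) auto
qed

section \<open>Empirical means\<close>

lemma indep_vars_PiM_component:
  assumes M: "\<And>i. i \<in> I \<Longrightarrow> prob_space (M i)" and I: "I \<noteq> {}"
  shows "prob_space.indep_vars (PiM I M) M (\<lambda>i \<omega>. \<omega> i) I"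
proof -
  interpret P: prob_space "PiM I M" by (rule prob_space_PiM) (rule M)
  have "distr (PiM I M) (PiM I M) (\<lambda>\<omega>. \<lambda>i\<in>I. \<omega> i) = distr (PiM I M) (PiM I M) (\<lambda>\<omega>. \<omega>)"
    by (rule distr_cong) (auto simp: space_PiM)
  also have "\<dots> = PiM I M" by (rule distr_id)
  also have "\<dots> = PiM I (\<lambda>i. distr (PiM I M) (M i) (\<lambda>\<omega>. \<omega> i))"
    by (rule PiM_cong) (simp_all add: distr_PiM_component M)
  finally show ?thesis
    using I by (subst P.indep_vars_iff_distr_eq_PiM') (auto simp: measurable_component_singleton)
qed

lemma iid_sum_nonpos_prob_le:
  fixes f :: "'a \<Rightarrow> real"
  assumes M: "prob_space M" and f: "f \<in> borel_measurable M" "\<And>x. \<bar>f x\<bar> \<le> 1"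
    and n: "0 < n" and pos: "0 < integral\<^sup>L M f"
  shows "measure (PiM {..<n} (\<lambda>_. M)) {\<omega> \<in> space (PiM {..<n} (\<lambda>_. M)). (\<Sum>i<n. f (\<omega> i)) \<le> 0}
    \<le> exp (- (real n * (integral\<^sup>L M f)\<^sup>2 / 2))"
proof -
  let ?P = "PiM {..<n} (\<lambda>_. M)"
  interpret P: prob_space ?P by (rule prob_space_PiM) (rule M)
  have "P.indep_vars (\<lambda>_. M) (\<lambda>i \<omega>. \<omega> i) {..<n}"
    using n by (intro indep_vars_PiM_component M) auto
  then have indep: "P.indep_vars (\<lambda>_. borel) (\<lambda>i \<omega>. f (\<omega> i)) {..<n}"
    by (rule P.indep_vars_compose2) (rule f(1))
  have E: "P.expectation (\<lambda>\<omega>. f (\<omega> i)) = integral\<^sup>L M f" if "i < n" for i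
  proof -
    have "P.expectation (\<lambda>\<omega>. f (\<omega> i)) = integral\<^sup>L (distr ?P M (\<lambda>\<omega>. \<omega> i)) f"
      using that f(1) by (intro integral_distr[symmetric]) auto
    then show ?thesis using that M by (subst (asm) distr_PiM_component) auto
  qed
  define \<mu> where "\<mu> = (\<Sum>i\<in>{..<n}. P.expectation (\<lambda>\<omega>. f (\<omega> i)))"
  interpret H: Hoeffding_ineq ?P "{..<n}" "\<lambda>i \<omega>. f (\<omega> i)" "\<lambda>_. -1" "\<lambda>_. 1" \<mu>
    using indep f(2) by unfold_locales (auto simp: \<mu>_def abs_le_iff minus_le_iff)
  have \<mu>: "\<mu> = real n * integral\<^sup>L M f" using E by (simp add: \<mu>_def)
  \<comment> \<open>The deviation is the whole mean \<open>\<mu>\<close>, so the threshold is 0.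
    Each summand ranges over an interval of length 2, hence the exponent
    \<open>- 2 * \<mu>\<^sup>2 / (4 * n)\<close>.\<close>
  have "P.prob {\<omega> \<in> space ?P. (\<Sum>i\<in>{..<n}. f (\<omega> i)) \<le> \<mu> - \<mu>}
      \<le> exp (- 2 * \<mu>\<^sup>2 / (\<Sum>i\<in>{..<n}. (1 - (- 1))\<^sup>2))"
    by (rule H.Hoeffding_ineq_le) (use n pos \<mu> in auto)
  also have "- 2 * \<mu>\<^sup>2 / (\<Sum>i\<in>{..<n}. (1 - (- 1))\<^sup>2) = - (real n * (integral\<^sup>L M f)\<^sup>2 / 2)"
    using n by (simp add: \<mu> power2_eq_square field_simps)
  finally show ?thesis by simp
qed

text \<open>Hoeffding's inequality bounds each failure, and a union bound over \<open>J\<close> is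
  eventually below \<open>\<delta>\<close>. An explicit measurable event is returned, so no
  measurability question about minimizers arises.\<close>

lemma iid_sums_positive:
  fixes f :: "'b \<Rightarrow> 'a \<Rightarrow> real"
  assumes M: "prob_space M" and J: "finite J"
    and f: "\<And>b. b \<in> J \<Longrightarrow> f b \<in> borel_measurable M" "\<And>b x. b \<in> J \<Longrightarrow> \<bar>f b x\<bar> \<le> 1"
    and pos: "\<And>b. b \<in> J \<Longrightarrow> 0 < integral\<^sup>L M (f b)"
    and T: "T \<in> sets M" "AE x in M. x \<in> T" and \<delta>: "0 < \<delta>"
  shows "\<exists>N::nat. \<forall>n>N. \<exists>A\<in>sets (PiM {..<n} (\<lambda>_. M)). measure (PiM {..<n} (\<lambda>_. M)) A \<ge> 1 - \<delta> \<and>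
    (\<forall>\<omega>\<in>A. (\<forall>i<n. \<omega> i \<in> T) \<and> (\<forall>b\<in>J. 0 < (\<Sum>i<n. f b (\<omega> i))))"
proof -
  have "\<forall>\<^sub>F n in sequentially. (\<Sum>b\<in>J. exp (- (real n * (integral\<^sup>L M (f b))\<^sup>2 / 2))) < \<delta>"
  proof -
    have "(\<lambda>n. exp (- (real n * (integral\<^sup>L M (f b))\<^sup>2 / 2))) \<longlonglongrightarrow> 0" if "b \<in> J" for b
    proof -
      define c where "c = (integral\<^sup>L M (f b))\<^sup>2 / 2"
      have "c > 0" using pos[OF that] by (simp add: c_def)
      then have "(\<lambda>n. exp (- c) ^ n) \<longlonglongrightarrow> 0" by (intro LIMSEQ_realpow_zero) auto
      then show ?thesis by (simp add: c_def exp_of_nat_mult[symmetric])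
    qed
    then have "(\<lambda>n. \<Sum>b\<in>J. exp (- (real n * (integral\<^sup>L M (f b))\<^sup>2 / 2))) \<longlonglongrightarrow> (\<Sum>b\<in>J. 0)"
      by (rule tendsto_sum)
    then show ?thesis using \<delta> by (auto intro: order_tendstoD(2))
  qed
  then obtain N where N: "\<And>n. n \<ge> N \<Longrightarrow> (\<Sum>b\<in>J. exp (- (real n * (integral\<^sup>L M (f b))\<^sup>2 / 2))) < \<delta>"
    unfolding eventually_sequentially by blast
  show ?thesis
  proof (intro exI[of _ N] allI impI)
    fix n assume n: "N < n"
    let ?P = "PiM {..<n} (\<lambda>_. M)"
    interpret P: prob_space ?P by (rule prob_space_PiM) (rule M)
    define B where "B = (\<lambda>b. {\<omega> \<in> space ?P. (\<Sum>i<n. f b (\<omega> i)) \<le> 0})"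
    define C where "C = {\<omega> \<in> space ?P. \<forall>i<n. \<omega> i \<in> T}"
    have comp: "(\<lambda>\<omega>. \<omega> i) \<in> measurable ?P M" if "i < n" for i
      using that by (intro measurable_component_singleton) auto
    have Bm: "B b \<in> P.events" if "b \<in> J" for b
    proof -
      have "(\<lambda>\<omega>. \<Sum>i<n. f b (\<omega> i)) \<in> borel_measurable ?P"
        using measurable_compose[OF comp f(1)[OF that]] by (intro borel_measurable_sum) auto
      then show ?thesis unfolding B_def by measurable
    qed
    have Cm: "C \<in> P.events"
    proof -
      have "C = (\<Inter>i\<in>{..<n}. (\<lambda>\<omega>. \<omega> i) -` T \<inter> space ?P)" using n by (auto simp: C_def)
      also have "\<dots> \<in> P.events"
      proof (rule sets.finite_INT)
        show "(\<lambda>\<omega>. \<omega> i) -` T \<inter> space ?P \<in> P.events" if "i \<in> {..<n}" for i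
          using measurable_sets[OF comp T(1), of i] that by simp
      qed (use n in auto)
      finally show ?thesis .
    qed
    have "AE \<omega> in ?P. \<omega> \<in> C"
    proof -
      have "AE \<omega> in ?P. \<forall>i\<in>{..<n}. \<omega> i \<in> T"
        by (subst AE_finite_all) (auto intro!: AE_PiM_component M T(2))
      then show ?thesis using AE_space[of ?P] by eventually_elim (auto simp: C_def)
    qed
    then have C1: "P.prob C = 1" using Cm P.prob_eq_1 by simp
    define D where "D = (\<Union>b\<in>J. B b)"
    have Dm: "D \<in> P.events" unfolding D_def using J Bm by (intro sets.finite_UN) auto
    have "P.prob D \<le> (\<Sum>b\<in>J. P.prob (B b))"
      unfolding D_def by (rule P.finite_measure_subadditive_finite) (use J Bm in auto)
    also have "\<dots> \<le> (\<Sum>b\<in>J. exp (- (real n * (integral\<^sup>L M (f b))\<^sup>2 / 2)))"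
      unfolding B_def using n f pos by (intro sum_mono iid_sum_nonpos_prob_le M) auto
    also have "\<dots> < \<delta>" using N n by simp
    finally have "P.prob D < \<delta>" .
    moreover have "P.prob C \<le> P.prob (C - D) + P.prob D"
    proof -
      have "P.prob C \<le> P.prob ((C - D) \<union> D)" using Cm Dm by (intro P.finite_measure_mono) auto
      also have "\<dots> \<le> P.prob (C - D) + P.prob D" using Cm Dm by (intro measure_Un_le) auto
      finally show ?thesis .
    qed
    ultimately have "P.prob (C - D) \<ge> 1 - \<delta>" using C1 by linarith
    moreover have "\<forall>\<omega>\<in>C - D. (\<forall>i<n. \<omega> i \<in> T) \<and> (\<forall>b\<in>J. 0 < (\<Sum>i<n. f b (\<omega> i)))"
      by (auto simp: C_def D_def B_def not_le)
    ultimately show "\<exists>A\<in>P.events. P.prob A \<ge> 1 - \<delta> \<and>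
        (\<forall>\<omega>\<in>A. (\<forall>i<n. \<omega> i \<in> T) \<and> (\<forall>b\<in>J. 0 < (\<Sum>i<n. f b (\<omega> i))))"
      using Cm Dm by (intro bexI[of _ "C - D"]) auto
  qed
qed

section \<open>Volume of the tube near a point\<close>

lemma mem_tube_iff:
  assumes "closed S" "S \<noteq> {}" shows "x \<in> tube S \<sigma> \<longleftrightarrow> infdist x S < \<sigma>"
proof -
  obtain p where p: "p \<in> S" "infdist x S = dist x p" using infdist_attains_inf[OF assms] by blast
  have "infdist x S < \<sigma>" if "q \<in> S" "dist x q < \<sigma>" for q
    using infdist_le[OF that(1), of x] that(2) by linarith
  then show ?thesis unfolding tube_def using p by auto
qed

lemma emeasure_lborel_open_nonzero:
  fixes A :: "'a::euclidean_space set"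
  assumes "open A" "x \<in> A" shows "emeasure lborel A \<noteq> 0"
proof -
  have "A \<in> sets lborel" using assms(1) by simp
  then have "A \<in> sets lebesgue" "emeasure lebesgue A = emeasure lborel A"
    by (auto intro: sets_completionI_sets simp: emeasure_completion)
  moreover have "\<not> negligible A" using open_not_negligible assms by blast
  ultimately show ?thesis using negligible_iff_emeasure0 by metis
qed

lemma open_tube: "open (tube S \<sigma>)"
proof -
  have "tube S \<sigma> = (\<Union>p\<in>S. ball p \<sigma>)" by (auto simp: tube_def dist_commute)
  then show ?thesis by auto
qed

lemma bounded_tube:
  fixes S :: "'a::euclidean_space set"
  assumes "bounded S" shows "bounded (tube S \<sigma>)"
proof -
  obtain B where B: "\<And>p. p \<in> S \<Longrightarrow> norm p \<le> B" using assms bounded_iff by metis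
  have "norm x \<le> B + \<sigma>" if x: "x \<in> tube S \<sigma>" for x
  proof -
    obtain p where "p \<in> S" "norm (x - p) < \<sigma>" using x by (auto simp: tube_def dist_norm)
    then show ?thesis using B[of p] norm_triangle_ineq2[of x p] by linarith
  qed
  then show ?thesis by (rule boundedI)
qed

text \<open>In the application \<open>p\<close> is the nearest point of \<open>r\<close>. The
  assumption \<open>ratio\<close> makes the tube thin at scale \<open>R\<close>: it gives
  \<open>10 * \<sigma> \<le> R\<close>.\<close>

locale local_frame = reach_submanifold S d \<tau> + P: orthogonal_projection "tangent_space S p" P
  for S :: "'a::euclidean_space set" and d \<tau> p P +
  fixes \<sigma> :: real and r :: 'a
  assumes d1: "1 \<le> d" and p: "p \<in> S" and \<sigma>: "0 < \<sigma>" and ratio: "100 * \<sigma> \<le> \<tau>"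
    and normal_r: "normal p (r - p)" and near_r: "norm (r - p) < \<sigma>"
begin

text \<open>The boxes \<open>G b\<close> around \<open>p + \<theta> R b\<close> and the box \<open>p + V\<close>, which contains the region of interest,
  are homothetic, so that the ratio of their volumes is \<open>c\<close> to the power of the dimension. The value of
  \<open>\<theta>\<close> keeps \<open>G b\<close> inside the tube; that of \<open>c\<close> makes the deviation of points of \<open>G b\<close> from the \<open>d\<close>
  basis directions small enough to be absorbed.\<close>

definition "R = sqrt (\<sigma> * \<tau>)"
definition "\<theta> = (1 / 25 :: real)"
definition "c = \<theta> / (2 * real d)"
definition "V = {x. norm (P x) \<le> R \<and> norm (x - P x) \<le> 2 * \<sigma>}"
definition "G b = (\<lambda>z. c *\<^sub>R z + (p + (\<theta> * R) *\<^sub>R b)) ` V"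

lemma scale_bounds: "R\<^sup>2 = \<sigma> * \<tau>" "0 < R" "10 * \<sigma> \<le> R"
proof -
  show sq: "R\<^sup>2 = \<sigma> * \<tau>" and pos: "0 < R" using \<sigma> \<tau>_pos by (simp_all add: R_def)
  have "(10 * \<sigma>)\<^sup>2 \<le> R\<^sup>2" unfolding sq using ratio \<sigma> by (simp add: power2_eq_square)
  then show "10 * \<sigma> \<le> R" using pos by (rule power2_le_imp_le[OF _ less_imp_le])
qed

lemma c_bounds: "0 < c" "c \<le> 1 / 50"
  using d1 by (auto simp: c_def \<theta>_def field_simps)

lemma P_normal: "P (r - p) = 0"
  using P.null normal_r unfolding normal_def by blast

lemma compact_V: "compact V"
proof -
  have cont: "continuous_on UNIV P" using P.lin linear_continuous_on linear_conv_bounded_linear by blast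
  have "closed V" unfolding V_def
    by (intro closed_Collect_conj closed_Collect_le continuous_intros cont)
  moreover have "bounded V"
  proof (rule boundedI)
    fix x assume "x \<in> V"
    then show "norm x \<le> R + 2 * \<sigma>"
      using norm_triangle_ineq[of "P x" "x - P x"] by (simp add: V_def)
  qed
  ultimately show ?thesis by (simp add: compact_eq_bounded_closed)
qed

lemma compact_G: "compact (G b)"
  unfolding G_def by (intro compact_continuous_image compact_V continuous_intros)

text \<open>A point \<open>m\<close> of \<open>S\<close> within \<open>\<sigma>\<close> of
  \<open>x\<close> has distance at most \<open>R + 2 * \<sigma> \<le> 6 / 5 * R\<close> from
  \<open>p\<close>, so it is within \<open>\<sigma>\<close> of the tangent plane. The bound serves
  both the inclusion in \<open>p + V\<close> and the cost of the candidate \<open>(p, T)\<close>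
  with \<open>T\<close> the tangent space at \<open>p\<close>.\<close>

lemma infdist_tangent_sample:
  assumes x: "x \<in> tube S \<sigma>" "norm (x - r) < R"
  shows "infdist (x - p) (tangent_space S p) \<le> 2 * \<sigma>"
proof -
  obtain m where m: "m \<in> S" "norm (x - m) < \<sigma>" using x(1) by (auto simp: tube_def dist_norm)
  have eq: "(x - r) + (r - p) - (x - m) = m - p" by simp
  have "norm (m - p) \<le> norm (x - r) + norm (r - p) + norm (x - m)"
    using norm_triangle_ineq4[of "(x - r) + (r - p)" "x - m"] norm_triangle_ineq[of "x - r" "r - p"]
    unfolding eq by linarith
  then have "norm (m - p) \<le> 6 / 5 * R" using m(2) x(2) near_r scale_bounds(3) by linarith
  then have "(norm (m - p))\<^sup>2 \<le> (6 / 5 * R)\<^sup>2" by (intro power_mono) auto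
  also have "\<dots> = 36 / 25 * (\<sigma> * \<tau>)" unfolding power_mult_distrib scale_bounds(1) by (simp add: power2_eq_square)
  finally have "(norm (m - p))\<^sup>2 \<le> 2 * (\<sigma> * \<tau>)" using mult_pos_pos[OF \<sigma> \<tau>_pos] by linarith
  then have "(norm (m - p))\<^sup>2 / (2 * \<tau>) \<le> \<sigma>" using \<tau>_pos by (simp add: pos_divide_le_eq mult_ac)
  then have 1: "infdist (m - p) (tangent_space S p) \<le> \<sigma>" using infdist_tangent_space_le[OF p m(1)] by linarith
  have "infdist (x - p) (tangent_space S p)
      \<le> infdist (x - m) (tangent_space S p) + infdist (m - p) (tangent_space S p)"
    using infdist_subspace_add[OF P.subsp, of "x - m" "m - p"] by simp
  also have "infdist (x - m) (tangent_space S p) \<le> norm (x - m)" by (rule infdist_subspace_le_norm[OF P.subsp])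
  finally show ?thesis using 1 m(2) by linarith
qed

text \<open>Since \<open>r - p\<close> is normal, \<open>P (x - p) = P (x - r)\<close>. The trivial
  factor \<open>1 *\<^sub>R z\<close> gives the image the form used by
  \<open>measure_lebesgue_affine\<close>.\<close>

lemma tube_ball_subset: "tube S \<sigma> \<inter> ball r R \<subseteq> (\<lambda>z. 1 *\<^sub>R z + p) ` V"
proof
  fix x assume "x \<in> tube S \<sigma> \<inter> ball r R"
  then have x: "x \<in> tube S \<sigma>" "norm (x - r) < R" by (auto simp: dist_norm norm_minus_commute)
  have "P (x - p) = P (x - r) + P (r - p)" using linear_add[OF P.lin, of "x - r" "r - p"] by simp
  then have "norm (P (x - p)) \<le> R" using P_normal P.norm_proj_le[of "x - r"] x(2) by simp
  moreover have "norm (x - p - P (x - p)) \<le> 2 * \<sigma>"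
    using infdist_tangent_sample[OF x] by (simp add: P.infdist_eq)
  ultimately have "x - p \<in> V" by (simp add: V_def)
  then show "x \<in> (\<lambda>z. 1 *\<^sub>R z + p) ` V" by (intro image_eqI[of _ _ "x - p"]) auto
qed

text \<open>A point of \<open>G b\<close> is \<open>p + v + w\<close> with \<open>v\<close> tangent
  of length at most \<open>2 / 25 * R\<close> and \<open>w\<close> of length at most
  \<open>2 / 25 * \<sigma>\<close>. The quadratic bound puts \<open>p + v\<close> within
  \<open>\<sigma> / 5\<close> of \<open>S\<close>, which leaves room for \<open>w\<close>.\<close>

lemma G_subset:
  assumes b: "b \<in> tangent_space S p" "norm b = 1"
  shows "G b \<subseteq> tube S \<sigma> \<inter> ball r R"
proof
  fix x assume "x \<in> G b"
  then obtain z where z: "norm (P z) \<le> R" "norm (z - P z) \<le> 2 * \<sigma>" "x = c *\<^sub>R z + (p + (\<theta> * R) *\<^sub>R b)"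
    by (auto simp: G_def V_def)
  define v where "v = c *\<^sub>R P z + (\<theta> * R) *\<^sub>R b"
  define w where "w = c *\<^sub>R (z - P z)"
  have x: "x = p + v + w" by (simp add: z(3) v_def w_def scaleR_diff_right)
  have v: "v \<in> tangent_space S p"
    unfolding v_def using P.subsp P.mem b(1) by (simp add: subspace_add subspace_scale)
  have "norm v \<le> c * norm (P z) + \<theta> * R"
    unfolding v_def using norm_triangle_ineq[of "c *\<^sub>R P z" "(\<theta> * R) *\<^sub>R b"] c_bounds b(2) scale_bounds(2) by (simp add: \<theta>_def)
  also have "\<dots> \<le> 1 / 50 * R + \<theta> * R" using c_bounds z(1) scale_bounds(2) by (intro add_right_mono mult_mono) auto
  finally have nv: "norm v \<le> 2 / 25 * R" using scale_bounds(2) by (simp add: \<theta>_def)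
  have "norm w = c * norm (z - P z)" using c_bounds by (simp add: w_def)
  also have "\<dots> \<le> 1 / 50 * (2 * \<sigma>)" using c_bounds z(2) \<sigma> by (intro mult_mono) auto
  finally have nw: "norm w \<le> 2 / 25 * \<sigma>" using \<sigma> by simp
  have "(norm v)\<^sup>2 \<le> (2 / 25 * R)\<^sup>2" using nv by (intro power_mono) auto
  also have "\<dots> = 4 / 625 * (\<sigma> * \<tau>)" unfolding power_mult_distrib scale_bounds(1) by (simp add: power2_eq_square)
  finally have "30 * (norm v)\<^sup>2 \<le> 1 / 5 * (\<sigma> * \<tau>)" using mult_pos_pos[OF \<sigma> \<tau>_pos] by linarith
  then have "30 * (norm v)\<^sup>2 / \<tau> \<le> 1 / 5 * \<sigma>" using \<tau>_pos by (simp add: pos_divide_le_eq)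
  then have "infdist (p + v) S \<le> 1 / 5 * \<sigma>" using infdist_tangent_le[OF p v] by linarith
  moreover have "infdist x S \<le> infdist (p + v) S + norm w"
    using infdist_triangle[of x S "p + v"] by (simp add: x dist_norm)
  ultimately have "infdist x S < \<sigma>" using nw \<sigma> by linarith
  then have "x \<in> tube S \<sigma>" using mem_tube_iff[OF closedS nonempty] by blast
  moreover have eq: "v + w - (r - p) = x - r" by (simp add: x)
  have "norm (x - r) \<le> norm v + norm w + norm (r - p)"
    using norm_triangle_ineq4[of "v + w" "r - p"] norm_triangle_ineq[of v w] unfolding eq by linarith
  then have "norm (x - r) < R" using nv nw near_r scale_bounds(2,3) by linarith
  ultimately show "x \<in> tube S \<sigma> \<inter> ball r R" by (simp add: dist_norm norm_minus_commute)
qed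

lemma borel_sets: "tube S \<sigma> \<in> sets borel" "tube S \<sigma> \<inter> ball r R \<in> sets borel" "G b \<in> sets borel"
  using compact_imp_closed[OF compact_G] by (auto intro: borel_open borel_closed open_Int open_tube)

lemma measure_G_ge:
  "c ^ DIM('a) * measure lborel (tube S \<sigma> \<inter> ball r R) \<le> measure lborel (G b)"
proof -
  have borel: "A \<in> sets borel \<Longrightarrow> measure lborel A = measure lebesgue A" for A :: "'a set"
    by (simp add: measure_completion)
  have G: "measure lebesgue (G b) = c ^ DIM('a) * measure lebesgue V"
    unfolding G_def measure_lebesgue_affine using c_bounds by simp
  have "measure lebesgue (tube S \<sigma> \<inter> ball r R) \<le> measure lebesgue ((\<lambda>z. 1 *\<^sub>R z + p) ` V)"
  proof (rule measure_mono_fmeasurable[OF tube_ball_subset])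
    show "tube S \<sigma> \<inter> ball r R \<in> sets lebesgue"
      using borel_sets by (intro sets_completionI_sets) auto
    show "(\<lambda>z. 1 *\<^sub>R z + p) ` V \<in> lmeasurable"
      by (intro lmeasurable_compact compact_continuous_image compact_V continuous_intros)
  qed
  also have "\<dots> = measure lebesgue V" unfolding measure_lebesgue_affine by simp
  finally have "c ^ DIM('a) * measure lebesgue (tube S \<sigma> \<inter> ball r R) \<le> measure lebesgue (G b)"
    unfolding G using c_bounds by (intro mult_left_mono) auto
  then show ?thesis
    using borel_sets by (subst (1 2) borel) auto
qed

text \<open>Half of the volume ratio in \<open>measure_G_ge\<close>, so that the comparison of
  expectations becomes strict.\<close>

definition "\<beta> = c ^ DIM('a) / 2"

lemma density_ratio: "0 < \<beta>" "\<beta> \<le> 1"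
  using c_bounds power_le_one[of c "DIM('a)"] by (auto simp: \<beta>_def)

text \<open>A positive sum over the samples says that more than the fraction \<open>\<beta>\<close>
  of those in the region of interest lie in \<open>G b\<close>. One bounded function thus replaces
  two separate counts.\<close>

definition "dens b x = indicator (G b) x - \<beta> * (indicator (tube S \<sigma> \<inter> ball r R) x :: real)"

lemma tube_lborel: "emeasure lborel (tube S \<sigma>) \<noteq> 0" "emeasure lborel (tube S \<sigma>) \<noteq> \<infinity>" "r \<in> tube S \<sigma>"
proof -
  show r: "r \<in> tube S \<sigma>" using p near_r by (auto simp: tube_def dist_norm)
  show "emeasure lborel (tube S \<sigma>) \<noteq> \<infinity>"
    using emeasure_bounded_finite[OF bounded_tube[OF compact_imp_bounded[OF compactS]]] by (simp add: less_top)
  show "emeasure lborel (tube S \<sigma>) \<noteq> 0"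
    using r open_tube emeasure_lborel_open_nonzero by blast
qed

lemma prob_space_Unif: "prob_space (Unif (tube S \<sigma>))"
  unfolding Unif_def by (rule prob_space_uniform_measure[OF tube_lborel(1,2)])

lemma dens_measurable: "dens b \<in> borel_measurable (Unif (tube S \<sigma>))"
proof -
  have "dens b \<in> borel_measurable borel"
    unfolding dens_def
    by (intro borel_measurable_diff borel_measurable_times borel_measurable_indicator borel_sets) simp
  then show ?thesis unfolding Unif_def by simp
qed

lemma dens_abs: "\<bar>dens b x\<bar> \<le> 1"
  using density_ratio by (auto simp: dens_def indicator_def)

lemma dens_integral_pos:
  assumes b: "b \<in> tangent_space S p" "norm b = 1"
  shows "0 < integral\<^sup>L (Unif (tube S \<sigma>)) (dens b)"
proof -
  let ?U = "Unif (tube S \<sigma>)"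
  let ?B = "tube S \<sigma> \<inter> ball r R"
  interpret U: prob_space ?U by (rule prob_space_Unif)
  have sets: "sets ?U = sets borel" by (simp add: Unif_def)
  have GB: "G b \<in> sets ?U" "?B \<in> sets ?U"
    unfolding sets by (rule borel_sets)+
  have "integral\<^sup>L ?U (dens b) = measure ?U (G b) - \<beta> * measure ?U ?B"
    unfolding dens_def using GB by (subst Bochner_Integration.integral_diff) (auto intro!: integrable_real_indicator simp: less_top[symmetric])
  also have "\<dots> = (measure lborel (G b) - \<beta> * measure lborel ?B) / measure lborel (tube S \<sigma>)"
  proof -
    have m: "measure ?U A = measure lborel A / measure lborel (tube S \<sigma>)"
      if "A \<in> sets borel" "A \<subseteq> tube S \<sigma>" for A
      unfolding Unif_def using tube_lborel open_tube that
      by (subst measure_uniform_measure) (auto simp: Int_absorb1)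
    show ?thesis
      using GB G_subset[OF b] sets by (subst (1 2) m) (auto simp: diff_divide_distrib)
  qed
  also have "\<dots> > 0"
  proof (rule divide_pos_pos)
    have pos: "0 < measure lborel A" if "open A" "r \<in> A" "bounded A" for A
      using emeasure_lborel_open_nonzero[OF that(1), of r] emeasure_bounded_finite[OF that(3)] that
      by (simp add: measure_def enn2real_positive_iff zero_less_iff_neq_zero)
    show "0 < measure lborel (tube S \<sigma>)"
      by (intro pos open_tube tube_lborel(3) bounded_tube compact_imp_bounded compactS)
    have "0 < measure lborel ?B"
      using tube_lborel(3) scale_bounds(2) by (intro pos open_Int open_tube bounded_Int) auto
    then have "\<beta> * measure lborel ?B < c ^ DIM('a) * measure lborel ?B" using c_bounds by (simp add: \<beta>_def)
    then show "0 < measure lborel (G b) - \<beta> * measure lborel ?B" using measure_G_ge[of b] by linarith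
  qed
  finally show ?thesis .
qed

end

section \<open>Minimizers of the empirical cost\<close>

text \<open>Applied to the supremum \<open>s\<close> of \<open>f\<close>, which is finite by
  \<open>bdd\<close>, the hypothesis gives \<open>s \<le> a + s / 2\<close>.\<close>

lemma le_of_le_half_bound:
  fixes f :: "'a \<Rightarrow> real"
  assumes bdd: "\<And>x. x \<in> A \<Longrightarrow> f x \<le> B"
    and step: "\<And>s. (\<And>x. x \<in> A \<Longrightarrow> f x \<le> s) \<Longrightarrow> (\<And>x. x \<in> A \<Longrightarrow> f x \<le> a + s / 2)"
    and x: "x \<in> A"
  shows "f x \<le> 2 * a"
proof -
  have bdd': "bdd_above (f ` A)" using bdd by (auto simp: bdd_above_def)
  have "f y \<le> a + (SUP x\<in>A. f x) / 2" if "y \<in> A" for y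
    by (rule step[OF _ that]) (rule cSUP_upper[OF _ bdd'])
  then have "(SUP x\<in>A. f x) \<le> a + (SUP x\<in>A. f x) / 2"
    using x by (intro cSUP_least) auto
  moreover have "f x \<le> (SUP x\<in>A. f x)" by (rule cSUP_upper[OF x bdd'])
  ultimately show ?thesis by linarith
qed

lemma orthonormal_expansion:
  fixes B :: "'a::euclidean_space set"
  assumes "pairwise orthogonal B" "\<And>b. b \<in> B \<Longrightarrow> norm b = 1" "finite B" "x \<in> span B"
  shows "x = (\<Sum>b\<in>B. (x \<bullet> b) *\<^sub>R b)"
proof -
  obtain u where u: "x = (\<Sum>b\<in>B. u b *\<^sub>R b)" using assms(3,4) by (auto simp: span_finite)
  have "x \<bullet> b = u b" if b: "b \<in> B" for b
  proof -
    have "x \<bullet> b = (\<Sum>a\<in>B. u a * (a \<bullet> b))" by (simp add: u inner_sum_left)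
    also have "\<dots> = (\<Sum>a\<in>B. if a = b then u b else 0)"
      using assms(1,2) b by (intro sum.cong) (auto simp: pairwise_def orthogonal_def norm_eq_1)
    also have "\<dots> = u b" using assms(3) b by simp
    finally show ?thesis .
  qed
  then show ?thesis using u by (metis (no_types, lifting) sum.cong)
qed

text \<open>Some point of \<open>S\<close> is within \<open>\<sigma>\<close> of \<open>r\<close>,
  and \<open>q\<close> is within \<open>2 * \<sigma>\<close> of \<open>r\<close>; no randomness is
  involved.\<close>

lemma step1_output_closest_point_le:
  fixes S :: "'a::euclidean_space set"
  assumes S: "closed S" and r: "r \<in> tube S \<sigma>" and out: "step1_output d \<sigma> \<tau> r n rs q H"
  shows "norm (closest_point S q - q) \<le> 3 * \<sigma>"
proof -
  obtain m where m: "m \<in> S" "dist r m < \<sigma>" using r by (auto simp: tube_def)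
  have "norm (r - q) < 2 * \<sigma>" using out by (auto simp: step1_output_def is_arg_min_def)
  then have "dist q m \<le> 3 * \<sigma>"
    using dist_triangle[of q m r] m(2) by (simp add: dist_norm norm_minus_commute)
  then show ?thesis
    using closest_point_le[OF S m(1), of q] by (simp add: dist_norm norm_minus_commute)
qed

section \<open>The residual of a minimizer and the angle it forces\<close>

context local_frame
begin

text \<open>Chosen so that \<open>\<beta> * (E * \<sigma>)\<^sup>2 = 16 * \<sigma>\<^sup>2\<close>,
  the mean residual allowed by \<open>step1_residual\<close>.\<close>

definition "E = 4 / sqrt \<beta>"

text \<open>Comparison with the admissible candidate at \<open>p\<close> bounds the mean cost of
  \<open>(q, H)\<close> by \<open>4 * \<sigma>\<^sup>2\<close>. Moving the base point from
  \<open>q\<close> to \<open>r\<close> costs less than \<open>2 * \<sigma>\<close> per distance, and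
  \<open>(x + y)\<^sup>2 \<le> 2 * x\<^sup>2 + 2 * y\<^sup>2\<close> gives 2 * 4 + 8 = 16.\<close>

lemma step1_residual:
  assumes rs: "\<And>i. i < n \<Longrightarrow> rs i \<in> tube S \<sigma>" and out: "step1_output d \<sigma> \<tau> r n rs q H"
  shows "(\<Sum>i\<in>ROI \<sigma> \<tau> r n rs. (infdist (rs i - r) H)\<^sup>2) \<le> 16 * \<sigma>\<^sup>2 * real (card (ROI \<sigma> \<tau> r n rs))"
proof (cases "card (ROI \<sigma> \<tau> r n rs) = 0")
  case True
  \<comment> \<open>Here \<open>J1\<close> is constantly 0 and minimality says nothing, but the sum
    to be bounded is empty.\<close>
  have "finite (ROI \<sigma> \<tau> r n rs)" by (simp add: ROI_def)
  then show ?thesis using True by simp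
next
  case False
  define I where "I = ROI \<sigma> \<tau> r n rs"
  define N where "N = real (card I)"
  have N: "N > 0" using False by (simp add: N_def I_def)
  have J: "J1 \<sigma> \<tau> r n rs q' H' = 1 / N * (\<Sum>i\<in>I. (infdist (rs i - q') H')\<^sup>2)" for q' H'
    by (simp add: J1_def I_def N_def)
  let ?T = "tangent_space S p"
  have H: "H \<in> Gr d" "norm (r - q) < 2 * \<sigma>"
      and min: "\<And>q' H'. H' \<in> Gr d \<Longrightarrow> (\<forall>h\<in>H'. orthogonal (r - q') h) \<Longrightarrow> norm (r - q') < 2 * \<sigma> \<Longrightarrow>
        J1 \<sigma> \<tau> r n rs q H \<le> J1 \<sigma> \<tau> r n rs q' H'"
    using out by (auto simp: step1_output_def is_arg_min_linorder)
  have subH: "subspace H" using H(1) by (simp add: Gr_def)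
  have "J1 \<sigma> \<tau> r n rs q H \<le> J1 \<sigma> \<tau> r n rs p ?T"
    using subspace_tangent[OF p] dim_tangent[OF p] normal_r near_r \<sigma>
    by (intro min) (auto simp: Gr_def normal_def orthogonal_def)
  then have "(\<Sum>i\<in>I. (infdist (rs i - q) H)\<^sup>2) \<le> (\<Sum>i\<in>I. (infdist (rs i - p) ?T)\<^sup>2)"
    unfolding J using N by (simp add: divide_le_cancel)
  also have "\<dots> \<le> (\<Sum>i\<in>I. (2 * \<sigma>)\<^sup>2)"
    by (intro sum_mono power_mono infdist_tangent_sample rs) (auto simp: I_def ROI_def R_def infdist_nonneg)
  also have "\<dots> = 4 * \<sigma>\<^sup>2 * N" by (simp add: N_def)
  finally have q: "(\<Sum>i\<in>I. (infdist (rs i - q) H)\<^sup>2) \<le> 4 * \<sigma>\<^sup>2 * N" .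
  have "(infdist (rs i - r) H)\<^sup>2 \<le> 2 * (infdist (rs i - q) H)\<^sup>2 + 8 * \<sigma>\<^sup>2" for i
  proof -
    have "infdist (rs i - r) H \<le> infdist (rs i - q) H + infdist (q - r) H"
      using infdist_subspace_add[OF subH, of "rs i - q" "q - r"] by simp
    also have "infdist (q - r) H \<le> norm (q - r)" by (rule infdist_subspace_le_norm[OF subH])
    finally have "infdist (rs i - r) H \<le> infdist (rs i - q) H + 2 * \<sigma>"
      using H(2) by (simp add: norm_minus_commute)
    then have "(infdist (rs i - r) H)\<^sup>2 \<le> (infdist (rs i - q) H + 2 * \<sigma>)\<^sup>2"
      by (intro power_mono infdist_nonneg)
    also have "\<dots> \<le> 2 * (infdist (rs i - q) H)\<^sup>2 + 8 * \<sigma>\<^sup>2"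
      using zero_le_power2[of "infdist (rs i - q) H - 2 * \<sigma>"] by (simp add: power2_eq_square algebra_simps)
    finally show ?thesis .
  qed
  then have "(\<Sum>i\<in>I. (infdist (rs i - r) H)\<^sup>2) \<le> (\<Sum>i\<in>I. 2 * (infdist (rs i - q) H)\<^sup>2 + 8 * \<sigma>\<^sup>2)"
    by (rule sum_mono)
  also have "\<dots> = 2 * (\<Sum>i\<in>I. (infdist (rs i - q) H)\<^sup>2) + 8 * \<sigma>\<^sup>2 * N"
    by (simp add: sum.distrib sum_distrib_left N_def)
  also have "\<dots> \<le> 16 * \<sigma>\<^sup>2 * N" using q by (simp add: algebra_simps)
  finally show ?thesis by (simp add: I_def N_def)
qed

text \<open>Markov's inequality by counting: if all of \<open>G b\<close> were far from
  \<open>r + H\<close>, the more than \<open>\<beta> * card I\<close> samples in it would alone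
  exceed the total residual.\<close>

lemma good_sample_exists:
  assumes rs: "\<And>i. i < n \<Longrightarrow> rs i \<in> tube S \<sigma>" and out: "step1_output d \<sigma> \<tau> r n rs q H"
    and b: "b \<in> tangent_space S p" "norm b = 1" and dens: "0 < (\<Sum>i<n. dens b (rs i))"
  shows "\<exists>x\<in>G b. infdist (x - r) H \<le> E * \<sigma>"
proof (rule ccontr)
  assume "\<not> ?thesis"
  then have far: "E * \<sigma> < infdist (x - r) H" if "x \<in> G b" for x using that by force
  define I where "I = ROI \<sigma> \<tau> r n rs"
  define K where "K = {i. i < n \<and> rs i \<in> G b}"
  have I: "I = {i. i < n \<and> rs i \<in> tube S \<sigma> \<inter> ball r R}"
    using rs by (auto simp: I_def ROI_def R_def dist_norm norm_minus_commute)
  have fin: "finite I" "finite K" by (auto simp: I K_def)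
  have KI: "K \<subseteq> I" using G_subset[OF b] by (auto simp: I K_def)
  have ind: "(\<Sum>i<n. indicator A (rs i)) = real (card {i. i < n \<and> rs i \<in> A})" for A
  proof -
    have "(\<Sum>i<n. indicator A (rs i)) = (\<Sum>i<n. if rs i \<in> A then 1 else 0 :: real)"
      by (intro sum.cong) (auto simp: indicator_def)
    also have "\<dots> = real (card ({..<n} \<inter> {i. rs i \<in> A}))" by (simp add: sum.If_cases)
    also have "{..<n} \<inter> {i. rs i \<in> A} = {i. i < n \<and> rs i \<in> A}" by auto
    finally show ?thesis .
  qed
  have "(\<Sum>i<n. dens b (rs i)) = real (card K) - \<beta> * real (card I)"
    unfolding dens_def sum_subtractf sum_distrib_left[symmetric] ind by (simp add: I K_def)
  then have KN: "\<beta> * real (card I) < real (card K)" using dens by simp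
  have E: "(E * \<sigma>)\<^sup>2 = 16 * \<sigma>\<^sup>2 / \<beta>" "E > 0"
    using density_ratio(1) by (auto simp: E_def power_mult_distrib power_divide)
  have "16 * \<sigma>\<^sup>2 * real (card I) = (\<beta> * real (card I)) * (16 * \<sigma>\<^sup>2 / \<beta>)" using density_ratio(1) by simp
  also have "\<dots> < real (card K) * (16 * \<sigma>\<^sup>2 / \<beta>)" using KN density_ratio(1) \<sigma> by (intro mult_strict_right_mono) auto
  also have "\<dots> = (\<Sum>i\<in>K. (E * \<sigma>)\<^sup>2)" by (simp add: E(1))
  also have "\<dots> \<le> (\<Sum>i\<in>K. (infdist (rs i - r) H)\<^sup>2)"
    using E(2) \<sigma> far by (intro sum_mono power_mono) (auto simp: K_def intro: less_imp_le)
  also have "\<dots> \<le> (\<Sum>i\<in>I. (infdist (rs i - r) H)\<^sup>2)" using fin KI by (intro sum_mono2) auto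
  also have "\<dots> \<le> 16 * \<sigma>\<^sup>2 * real (card I)" using step1_residual[OF rs out] by (simp add: I_def)
  finally show False by simp
qed

text \<open>The good sample expresses \<open>(\<theta> * R) *\<^sub>R b\<close> as a vector near
  \<open>H\<close>, an error of size at most \<open>2 * \<sigma>\<close>, and a tangent vector of
  length at most \<open>c * R\<close>. The last is bounded through the supremum \<open>s\<close>
  being estimated; summed over the \<open>d\<close> basis vectors it contributes
  \<open>s / 2\<close>, which is absorbed.\<close>

lemma infdist_tangent_plane_le:
  assumes H: "subspace H" and B: "B \<subseteq> tangent_space S p" "pairwise orthogonal B" "\<And>b. b \<in> B \<Longrightarrow> norm b = 1"
      "finite B" "card B = d" "span B = tangent_space S p"
    and good: "\<And>b. b \<in> B \<Longrightarrow> \<exists>x\<in>G b. infdist (x - r) H \<le> E * \<sigma>"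
    and u: "u \<in> tangent_space S p" "norm u = 1"
  shows "infdist u H \<le> 50 * real d * (E + 2) * (\<sigma> / R)"
proof -
  let ?T = "tangent_space S p"
  have "infdist u H \<le> 2 * (25 * real d * (E + 2) * (\<sigma> / R))"
  proof (rule le_of_le_half_bound[where A = "{u \<in> ?T. norm u = 1}" and f = "\<lambda>u. infdist u H"])
    show "infdist v H \<le> 1" if "v \<in> {u \<in> ?T. norm u = 1}" for v
      using infdist_subspace_le_norm[OF H, of v] that by simp
    fix s v assume s: "\<And>v. v \<in> {u \<in> ?T. norm u = 1} \<Longrightarrow> infdist v H \<le> s" and v: "v \<in> {u \<in> ?T. norm u = 1}"
    have sT: "infdist w H \<le> norm w * s" if "w \<in> ?T" for w
    proof (cases "w = 0")
      case True then show ?thesis using infdist_subspace_le_norm[OF H, of 0] by simp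
    next
      case False
      have "infdist w H = norm w * infdist (w /\<^sub>R norm w) H"
        using infdist_subspace_scale[OF H, of "norm w" "w /\<^sub>R norm w"] False by simp
      also have "\<dots> \<le> norm w * s"
        using that False P.subsp by (intro mult_left_mono s) (auto simp: subspace_scale)
      finally show ?thesis .
    qed
    have s0: "0 \<le> s" using s[OF v] infdist_nonneg[of v H] by linarith
    have basis: "infdist b H \<le> 25 * (E + 2) * (\<sigma> / R) + s / (2 * real d)" if b: "b \<in> B" for b
    proof -
      obtain x where x: "x \<in> G b" "infdist (x - r) H \<le> E * \<sigma>" using good[OF b] by blast
      then obtain z where z: "norm (P z) \<le> R" "norm (z - P z) \<le> 2 * \<sigma>" "x = c *\<^sub>R z + (p + (\<theta> * R) *\<^sub>R b)"
        by (auto simp: G_def V_def)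
      define w where "w = (r - p) - c *\<^sub>R (z - P z)"
      have eq: "(\<theta> * R) *\<^sub>R b = (x - r) + (w + (- c) *\<^sub>R P z)"
        by (simp add: z(3) w_def scaleR_diff_right)
      have "norm w \<le> norm (r - p) + c * norm (z - P z)"
        unfolding w_def using norm_triangle_ineq4[of "r - p" "c *\<^sub>R (z - P z)"] c_bounds by simp
      also have "\<dots> \<le> \<sigma> + 1 / 50 * (2 * \<sigma>)" using near_r c_bounds z(2) \<sigma> by (intro add_mono mult_mono) auto
      finally have w: "infdist w H \<le> 2 * \<sigma>" using infdist_subspace_le_norm[OF H, of w] \<sigma> by linarith
      have "infdist ((- c) *\<^sub>R P z) H = c * infdist (P z) H"
        unfolding infdist_subspace_scale[OF H] using c_bounds by simp
      also have "\<dots> \<le> c * (norm (P z) * s)" using sT[OF P.mem] c_bounds by (intro mult_left_mono) auto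
      also have "\<dots> \<le> c * (R * s)" using z(1) s0 c_bounds by (intro mult_left_mono mult_right_mono) auto
      finally have "infdist (w + (- c) *\<^sub>R P z) H \<le> 2 * \<sigma> + c * (R * s)"
        using infdist_subspace_add[OF H, of w "(- c) *\<^sub>R P z"] w by linarith
      then have "infdist ((\<theta> * R) *\<^sub>R b) H \<le> E * \<sigma> + (2 * \<sigma> + c * (R * s))"
        unfolding eq using infdist_subspace_add[OF H, of "x - r" "w + (- c) *\<^sub>R P z"] x(2) by linarith
      moreover have "infdist ((\<theta> * R) *\<^sub>R b) H = \<theta> * R * infdist b H"
        unfolding infdist_subspace_scale[OF H] using scale_bounds(2) by (simp add: \<theta>_def)
      ultimately have "\<theta> * R * infdist b H \<le> E * \<sigma> + (2 * \<sigma> + c * (R * s))" by linarith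
      \<comment> \<open>Here \<open>1 / \<theta> = 25\<close> and
        \<open>c / \<theta> = 1 / (2 * d)\<close>.\<close>
      also have "\<dots> = \<theta> * R * (25 * (E + 2) * (\<sigma> / R) + s / (2 * real d))"
        using scale_bounds(2) d1 by (simp add: c_def \<theta>_def field_simps)
      finally have "\<theta> * R * infdist b H \<le> \<theta> * R * (25 * (E + 2) * (\<sigma> / R) + s / (2 * real d))" .
      then show ?thesis using scale_bounds(2) by (simp add: \<theta>_def)
    qed
    have "infdist v H = infdist (\<Sum>b\<in>B. (v \<bullet> b) *\<^sub>R b) H"
      using orthonormal_expansion[OF B(2,3,4), of v] v B(6) by simp
    also have "\<dots> \<le> (\<Sum>b\<in>B. infdist ((v \<bullet> b) *\<^sub>R b) H)" by (rule infdist_subspace_sum[OF H B(4)])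
    also have "\<dots> \<le> (\<Sum>b\<in>B. 25 * (E + 2) * (\<sigma> / R) + s / (2 * real d))"
    proof (rule sum_mono)
      fix b assume b: "b \<in> B"
      have "infdist ((v \<bullet> b) *\<^sub>R b) H = \<bar>v \<bullet> b\<bar> * infdist b H" by (rule infdist_subspace_scale[OF H])
      also have "\<dots> \<le> 1 * infdist b H"
        using abs_inner_le_1[of v b] v B(3)[OF b] by (intro mult_right_mono infdist_nonneg) auto
      finally show "infdist ((v \<bullet> b) *\<^sub>R b) H \<le> 25 * (E + 2) * (\<sigma> / R) + s / (2 * real d)"
        using basis[OF b] by simp
    qed
    also have "\<dots> = 25 * real d * (E + 2) * (\<sigma> / R) + s / 2"
      using d1 by (simp add: B(5) distrib_left)
    finally show "infdist v H \<le> 25 * real d * (E + 2) * (\<sigma> / R) + s / 2" .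
  qed (use u in auto)
  then show ?thesis by simp
qed

text \<open>A unit tangent vector at \<open>p'\<close> is projected to the tangent space at
  \<open>p\<close> and compared there with \<open>H\<close>. The points \<open>p'\<close> and
  \<open>p\<close> are at most \<open>3 * \<sigma> + 2 * \<sigma> + \<sigma>\<close> apart, which
  gives 84 = 14 * 6.\<close>

lemma step1_angle_le:
  assumes B: "B \<subseteq> tangent_space S p" "pairwise orthogonal B" "\<And>b. b \<in> B \<Longrightarrow> norm b = 1"
      "finite B" "card B = d" "span B = tangent_space S p"
    and rs: "\<And>i. i < n \<Longrightarrow> rs i \<in> tube S \<sigma>" and out: "step1_output d \<sigma> \<tau> r n rs q H"
    and dens: "\<And>b. b \<in> B \<Longrightarrow> 0 < (\<Sum>i<n. dens b (rs i))"
    and \<kappa>: "\<kappa> = (50 * real d * (E + 2) + 84) * sqrt (\<sigma> / \<tau>)" "\<kappa> < 1"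
  shows "max_principal_angle H (tangent_space S (closest_point S q)) \<le> 2 * \<kappa>"
proof -
  let ?T = "tangent_space S p"
  define p' where "p' = closest_point S q"
  have p': "p' \<in> S" using closest_mem by (simp add: p'_def)
  have H: "subspace H" "dim H = d" "norm (r - q) < 2 * \<sigma>"
    using out by (auto simp: step1_output_def is_arg_min_def Gr_def)
  have E: "E > 0" using density_ratio(1) by (simp add: E_def)
  have good: "\<exists>x\<in>G b. infdist (x - r) H \<le> E * \<sigma>" if "b \<in> B" for b
    by (rule good_sample_exists[OF rs out _ B(3)[OF that] dens[OF that]]) (use B(1) that in auto)
  have s: "infdist u H \<le> 50 * real d * (E + 2) * (\<sigma> / R)" if "u \<in> ?T" "norm u = 1" for u
    by (rule infdist_tangent_plane_le[OF H(1) B good that])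
  define \<rho> where "\<rho> = sqrt (\<sigma> / \<tau>)"
  have \<rho>: "0 \<le> \<rho>" "\<rho> \<le> 1" "\<sigma> / \<tau> = \<rho>\<^sup>2"
    using \<sigma> \<tau>_pos ratio by (auto simp: \<rho>_def real_sqrt_le_1_iff)
  have "\<sigma> / R = \<rho>"
  proof -
    have "\<rho> * R = sqrt (\<sigma> * \<sigma>)"
      unfolding \<rho>_def R_def real_sqrt_mult[symmetric] using \<tau>_pos by simp
    then show ?thesis using \<sigma> scale_bounds(2) by (simp add: field_simps)
  qed
  with s have s\<rho>: "infdist u H \<le> 50 * real d * (E + 2) * \<rho>" if "u \<in> ?T" "norm u = 1" for u
    using that by simp
  have K0: "0 \<le> 50 * real d * (E + 2) * \<rho>" using E \<rho>(1) by simp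
  have "norm (p' - q) \<le> 3 * \<sigma>"
    unfolding p'_def by (rule step1_output_closest_point_le[OF closedS tube_lborel(3) out])
  moreover have eq: "(p' - q) - (r - q) + (r - p) = p' - p" by simp
  then have "norm (p' - p) \<le> norm (p' - q) + norm (r - q) + norm (r - p)"
    using norm_triangle_ineq[of "(p' - q) - (r - q)" "r - p"] norm_triangle_ineq4[of "p' - q" "r - q"]
    unfolding eq by linarith
  ultimately have pp: "norm (p' - p) \<le> 6 * \<sigma>" using H(3) near_r by linarith
  have "infdist y H \<le> \<kappa>" if y: "y \<in> tangent_space S p'" "norm y = 1" for y
  proof -
    have "infdist y ?T \<le> 14 * norm (p' - p) / \<tau>" by (rule infdist_tangent_spaces_le[OF p' p y])
    also have "\<dots> \<le> 84 * (\<sigma> / \<tau>)" using pp \<tau>_pos by (simp add: divide_right_mono)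
    \<comment> \<open>As \<open>\<rho> \<le> 1\<close>, the term of order
      \<open>\<rho>\<^sup>2\<close> is absorbed into the main order \<open>\<rho>\<close>.\<close>
    also have "\<dots> \<le> 84 * \<rho>" using \<rho> by (simp add: power2_eq_square mult_left_le)
    finally have 1: "norm (y - P y) \<le> 84 * \<rho>" by (simp add: P.infdist_eq)
    have 2: "infdist (P y) H \<le> 50 * real d * (E + 2) * \<rho>"
    proof (cases "P y = 0")
      case True
      then have "infdist (P y) H \<le> 0" using infdist_subspace_le_norm[OF H(1), of 0] by simp
      then show ?thesis using K0 by linarith
    next
      case False
      have "infdist (P y) H = norm (P y) * infdist (P y /\<^sub>R norm (P y)) H"
        using infdist_subspace_scale[OF H(1), of "norm (P y)" "P y /\<^sub>R norm (P y)"] False by simp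
      also have "\<dots> \<le> 1 * (50 * real d * (E + 2) * \<rho>)"
        using P.norm_proj_le[of y] y(2) False P.mem P.subsp
        by (intro mult_mono s\<rho>) (auto simp: subspace_scale infdist_nonneg)
      finally show ?thesis by simp
    qed
    have "infdist y H \<le> infdist (P y) H + infdist (y - P y) H"
      using infdist_subspace_add[OF H(1), of "P y" "y - P y"] by simp
    also have "infdist (y - P y) H \<le> norm (y - P y)" by (rule infdist_subspace_le_norm[OF H(1)])
    finally show ?thesis using 1 2 by (simp add: \<kappa>(1) \<rho>_def[symmetric] distrib_right)
  qed
  moreover have "0 \<le> \<kappa>" using K0 \<rho>(1) by (simp add: \<kappa>(1) \<rho>_def[symmetric] distrib_right)
  ultimately show ?thesis
    using H d1 \<kappa>(2) subspace_tangent[OF p'] dim_tangent[OF p']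
    unfolding p'_def[symmetric] by (intro max_principal_angle_le) auto
qed

text \<open>The event is fixed before \<open>q\<close> and \<open>H\<close>: all samples lie in the
  tube and the sum of \<open>dens b\<close> is positive for each vector of one basis
  \<open>B\<close>. Every minimizer is then handled deterministically.\<close>

lemma step1_angle_probability:
  assumes \<kappa>: "\<kappa> = (50 * real d * (E + 2) + 84) * sqrt (\<sigma> / \<tau>)" "\<kappa> < 1" and \<delta>: "0 < \<delta>"
  shows "\<exists>N::nat. \<forall>n>N. \<exists>A\<in>sets (iid_samples n (tube S \<sigma>)). measure (iid_samples n (tube S \<sigma>)) A \<ge> 1 - \<delta> \<and>
    (\<forall>rs\<in>A. \<forall>q H. step1_output d \<sigma> \<tau> r n rs q H \<longrightarrow>
      max_principal_angle H (tangent_space S (closest_point S q)) \<le> 2 * \<kappa>)"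
proof -
  obtain B where B: "B \<subseteq> tangent_space S p" "pairwise orthogonal B" "\<And>b. b \<in> B \<Longrightarrow> norm b = 1"
      "independent B" "card B = d" "span B = tangent_space S p"
    using orthonormal_basis_subspace[OF subspace_tangent[OF p]] dim_tangent[OF p] by metis
  have fin: "finite B" using B(4) independent_imp_finite by blast
  have "\<exists>N::nat. \<forall>n>N. \<exists>A\<in>sets (PiM {..<n} (\<lambda>_. Unif (tube S \<sigma>))).
      measure (PiM {..<n} (\<lambda>_. Unif (tube S \<sigma>))) A \<ge> 1 - \<delta> \<and>
      (\<forall>\<omega>\<in>A. (\<forall>i<n. \<omega> i \<in> tube S \<sigma>) \<and> (\<forall>b\<in>B. 0 < (\<Sum>i<n. dens b (\<omega> i))))"
  proof (rule iid_sums_positive[OF prob_space_Unif fin dens_measurable dens_abs _ _ _ \<delta>])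
    show "0 < integral\<^sup>L (Unif (tube S \<sigma>)) (dens b)" if "b \<in> B" for b
      using dens_integral_pos B(1,3) that by blast
    show "tube S \<sigma> \<in> sets (Unif (tube S \<sigma>))" using borel_sets(1) by (simp add: Unif_def)
    show "AE x in Unif (tube S \<sigma>). x \<in> tube S \<sigma>"
      unfolding Unif_def using borel_sets(1) by (intro AE_uniform_measureI) auto
  qed
  moreover have "max_principal_angle H (tangent_space S (closest_point S q)) \<le> 2 * \<kappa>"
    if "\<forall>i<n. rs i \<in> tube S \<sigma>" "\<forall>b\<in>B. 0 < (\<Sum>i<n. dens b (rs i))" "step1_output d \<sigma> \<tau> r n rs q H"
    for n rs q H
    by (rule step1_angle_le[OF B(1,2,3) fin B(5,6) _ that(3) _ \<kappa>]) (use that(1,2) in auto)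
  ultimately show ?thesis unfolding iid_samples_def by meson
qed

end

section \<open>Constants uniform over all submanifolds\<close>

theorem theorem3p2:
  fixes d k :: nat
  assumes "1 \<le> d" and "d < CARD('D::finite)" and "1 \<le> k"
  shows "\<exists>C\<^sub>M>0. \<exists>M\<^sub>0>0.
    \<forall>(\<M> :: (real ^ 'D) set) (\<tau> :: real) (\<sigma> :: real) (r :: real ^ 'D).
      compact \<M> \<longrightarrow> submanifold k d \<M> \<longrightarrow> reach \<M> = ereal \<tau> \<longrightarrow> \<sigma> > 0 \<longrightarrow>
      \<tau> / \<sigma> > M\<^sub>0 \<longrightarrow> r \<in> tube \<M> \<sigma> \<longrightarrow>
      (\<forall>\<delta>>0. \<exists>N\<^sub>\<delta>::nat. \<forall>n>N\<^sub>\<delta>.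
         \<exists>A \<in> sets (iid_samples n (tube \<M> \<sigma>)).
           measure (iid_samples n (tube \<M> \<sigma>)) A \<ge> 1 - \<delta> \<and>
           (\<forall>rs\<in>A. \<forall>q H. step1_output d \<sigma> \<tau> r n rs q H \<longrightarrow>
              max_principal_angle H (tangent_space \<M> (closest_point \<M> q))
                \<le> sqrt (C\<^sub>M / (\<tau> / \<sigma>)))) \<and>
      (\<forall>n rs q H. step1_output d \<sigma> \<tau> r n rs q H \<longrightarrow>
         norm (closest_point \<M> q - q) \<le> 3 * \<sigma>)"
proof -
  \<comment> \<open>The constant has to be named before the submanifold, so \<open>\<beta>\<close>
    and \<open>E\<close> are written out in terms of \<open>d\<close> and the ambient dimension;
    \<open>K_eq\<close> identifies them later.\<close>
  define \<beta>\<^sub>0 :: real where "\<beta>\<^sub>0 = (1 / 25 / (2 * real d)) ^ DIM(real ^ 'D) / 2"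
  define K where "K = 50 * real d * (4 / sqrt \<beta>\<^sub>0 + 2) + 84"
  have "\<beta>\<^sub>0 > 0" using assms(1) by (simp add: \<beta>\<^sub>0_def)
  then have "K \<ge> 84" by (simp add: K_def)
  then have K: "K > 0" "100 \<le> 4 * K\<^sup>2" using power_mono[of 84 K 2] by auto
  \<comment> \<open>The value \<open>4 * K\<^sup>2\<close> serves as both \<open>C\<^sub>M\<close>
    and \<open>M\<^sub>0\<close>: it makes \<open>2 * \<kappa>\<close> equal to
    \<open>sqrt (C\<^sub>M / M)\<close>, which is below 1 for \<open>M > C\<^sub>M\<close>, and
    being at least 100 it also yields \<open>ratio\<close>.\<close>
  show ?thesis
  proof (intro exI[of _ "4 * K\<^sup>2"] conjI allI impI)
    show "0 < 4 * K\<^sup>2" "0 < 4 * K\<^sup>2" using K by auto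
  next
    fix \<M> :: "(real ^ 'D) set" and \<tau> \<sigma> :: real and r n rs q H
    assume "compact \<M>" "r \<in> tube \<M> \<sigma>" "step1_output d \<sigma> \<tau> r n rs q H"
    then show "norm (closest_point \<M> q - q) \<le> 3 * \<sigma>"
      using step1_output_closest_point_le compact_imp_closed by blast
  next
    fix \<M> :: "(real ^ 'D) set" and \<tau> \<sigma> :: real and r :: "real ^ 'D" and \<delta> :: real
    assume *: "compact \<M>" "submanifold k d \<M>" "reach \<M> = ereal \<tau>" "\<sigma> > 0" "\<tau> / \<sigma> > 4 * K\<^sup>2"
      "r \<in> tube \<M> \<sigma>" "\<delta> > 0"
    have ne: "\<M> \<noteq> {}" using *(6) by (auto simp: tube_def)
    have big: "4 * K\<^sup>2 * \<sigma> < \<tau>" using *(4,5) by (simp add: pos_less_divide_eq)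
    moreover have "100 * \<sigma> \<le> 4 * K\<^sup>2 * \<sigma>" using K(2) *(4) by (intro mult_right_mono) auto
    ultimately have ratio: "100 * \<sigma> \<le> \<tau>" by linarith
    then have \<tau>: "\<tau> > 0" using *(4) by linarith
    interpret reach_submanifold \<M> d \<tau> by (rule reach_submanifoldI[OF *(2) assms(3) *(1) ne *(3) \<tau>])
    define p where "p = closest_point \<M> r"
    have p: "p \<in> \<M>" using closest_mem by (simp add: p_def)
    obtain P where "orthogonal_projection (tangent_space \<M> p) P"
      using orthogonal_projection_obtain[OF subspace_tangent[OF p]] .
    then interpret P: orthogonal_projection "tangent_space \<M> p" P .
    have "norm (r - p) < \<sigma>"
      using *(6) mem_tube_iff[OF closedS nonempty] infdist_eq by (simp add: p_def dist_norm)
    moreover have "normal p (r - p)" unfolding p_def by (rule normal_closest)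
    ultimately interpret local_frame \<M> d \<tau> p P \<sigma> r
      using assms(1) p *(4) ratio by unfold_locales auto
    have K_eq: "K = 50 * real d * (E + 2) + 84"
      by (simp add: K_def E_def \<beta>_def \<beta>\<^sub>0_def c_def \<theta>_def)
    define \<kappa> where "\<kappa> = K * sqrt (\<sigma> / \<tau>)"
    have "2 * \<kappa> = sqrt ((2 * K)\<^sup>2) * sqrt (\<sigma> / \<tau>)"
      unfolding \<kappa>_def real_sqrt_abs using K(1) by simp
    also have "\<dots> = sqrt ((2 * K)\<^sup>2 * (\<sigma> / \<tau>))" by (rule real_sqrt_mult[symmetric])
    also have "(2 * K)\<^sup>2 * (\<sigma> / \<tau>) = 4 * K\<^sup>2 / (\<tau> / \<sigma>)" by (simp add: power_mult_distrib)
    finally have \<kappa>: "2 * \<kappa> = sqrt (4 * K\<^sup>2 / (\<tau> / \<sigma>))" .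
    have "4 * K\<^sup>2 / (\<tau> / \<sigma>) < 1" using big \<tau> *(4) by (simp add: field_simps)
    then have "2 * \<kappa> < 1" unfolding \<kappa> by simp
    moreover have "0 \<le> \<kappa>" using K(1) *(4) \<tau> by (simp add: \<kappa>_def)
    ultimately have "\<kappa> < 1" by linarith
    from step1_angle_probability[OF \<kappa>_def[unfolded K_eq] this *(7)]
    show "\<exists>N\<^sub>\<delta>::nat. \<forall>n>N\<^sub>\<delta>. \<exists>A \<in> sets (iid_samples n (tube \<M> \<sigma>)).
           measure (iid_samples n (tube \<M> \<sigma>)) A \<ge> 1 - \<delta> \<and>
           (\<forall>rs\<in>A. \<forall>q H. step1_output d \<sigma> \<tau> r n rs q H \<longrightarrow>
              max_principal_angle H (tangent_space \<M> (closest_point \<M> q))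
                \<le> sqrt (4 * K\<^sup>2 / (\<tau> / \<sigma>)))"
      unfolding \<kappa> .
  qed
qed

end
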